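(* For every integer $n \geqslant 1$, the $n$-dimensional cross-polytope can be constructively lattice packed in $\mathbb{R}^n$ with density $$\max_{1 \leqslant t \leqslant n} \frac{(2t)^n}{n!\, \operatorname{p}(n)^t},$$ where the maximum is over integers $t$ and $\operatorname{p}(n)$ denotes the smallest prime larger than $n$. Here "constructively" means that there is an algorithm which, given $n$, produces the lattice (e.g., a list of its basis vectors) and whose complexity grows polynomially with $n$.
   Context: The $n$-dimensional cross-polytope is $C_n = \{ \boldsymbol{y} \in \mathbb{R}^n : \sum_{i=1}^n |y_i| \leqslant 1 \}$, the unit ball of the $\ell_1$ metric. The cross-polytope of radius $r$ is $rC_n = \{ r\boldsymbol{y} : \boldsymbol{y} \in C_n \}$, which has volume $\frac{(2r)^n}{n!}$. A lattice packing of cross-polytopes of radius $r$ is an arrangement of the form $\mathcal{L} + rC_n = \{ \boldsymbol{x} + \boldsymbol{y} : \boldsymbol{x} \in \mathcal{L}, \boldsymbol{y} \in rC_n \}$, where $\mathcal{L}$ is a lattice (a discrete additive subgroup of $\mathbb{R}^n$, of full rank) with minimum $\ell_1$ distance between distinct points $\geqslant 2r$. The density of such a packing is $\frac{(2r)^n}{n!\, \det \mathcal{L}}$, where $\det \mathcal{L}$ is the volume of a fundamental cell of $\mathcal{L}$. *)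

theory Defs
  imports "HOL-Analysis.Analysis" "HOL-Computational_Algebra.Computational_Algebra"
begin

section \<open>Lattice packings of cross-polytopes\<close>

text \<open>
  The dimension has to be a term, since a single algorithm serves all dimensions. So $R^n$ is
  the library's \<^const>\<open>Euclidean_space\<close> \<open>n\<close>: functions \<open>nat \<Rightarrow> real\<close> that vanish from index
  \<open>n\<close> on. A family of \<open>n\<close> vectors is a function \<open>b\<close> of which only \<open>b 0, \<dots>, b (n - 1)\<close> matter.
\<close>

definition l1_dist :: "nat \<Rightarrow> (nat \<Rightarrow> real) \<Rightarrow> (nat \<Rightarrow> real) \<Rightarrow> real" where
  "l1_dist n x y = (\<Sum>i<n. \<bar>x i - y i\<bar>)"

definition lin_indep :: "nat \<Rightarrow> (nat \<Rightarrow> nat \<Rightarrow> real) \<Rightarrow> bool" where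
  "lin_indep n b \<longleftrightarrow> (\<forall>c. (\<forall>j<n. (\<Sum>i<n. c i * b i j) = 0) \<longrightarrow> (\<forall>i<n. c i = 0))"

definition is_lattice :: "nat \<Rightarrow> (nat \<Rightarrow> real) set \<Rightarrow> bool" where
  "is_lattice n L \<longleftrightarrow>
     L \<subseteq> topspace (Euclidean_space n) \<and>
     (\<lambda>j. 0) \<in> L \<and>
     (\<forall>x\<in>L. \<forall>y\<in>L. (\<lambda>j. x j - y j) \<in> L) \<and>
     subtopology (Euclidean_space n) L = discrete_topology L \<and>
     (\<exists>v. (\<forall>i<n. v i \<in> L) \<and> lin_indep n v)"

definition lattice_basis :: "nat \<Rightarrow> (nat \<Rightarrow> nat \<Rightarrow> real) \<Rightarrow> (nat \<Rightarrow> real) set \<Rightarrow> bool" where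
  "lattice_basis n b L \<longleftrightarrow>
     (\<forall>i<n. b i \<in> topspace (Euclidean_space n)) \<and>
     lin_indep n b \<and>
     L = {(\<lambda>j. \<Sum>i<n. of_int (k i) * b i j) | k :: nat \<Rightarrow> int. True}"

text \<open>Lebesgue measure; \<^const>\<open>restrict\<close> passes from vectors padded with \<open>0\<close> to the extensional
  functions that form the product space.\<close>

definition volume :: "nat \<Rightarrow> (nat \<Rightarrow> real) set \<Rightarrow> real" where
  "volume n S = measure (Pi\<^sub>M {..<n} (\<lambda>_. lborel)) ((\<lambda>x. restrict x {..<n}) ` S)"

definition fundamental_cell :: "nat \<Rightarrow> (nat \<Rightarrow> nat \<Rightarrow> real) \<Rightarrow> (nat \<Rightarrow> real) set" where
  "fundamental_cell n b =
     {(\<lambda>j. \<Sum>i<n. c i * b i j) | c :: nat \<Rightarrow> real. \<forall>i<n. 0 \<le> c i \<and> c i < 1}"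

text \<open>The determinant of the lattice with basis \<open>b\<close>; it is the same for all bases of the lattice.\<close>

definition lattice_det :: "nat \<Rightarrow> (nat \<Rightarrow> nat \<Rightarrow> real) \<Rightarrow> real" where
  "lattice_det n b = volume n (fundamental_cell n b)"

definition lattice_packing :: "nat \<Rightarrow> (nat \<Rightarrow> real) set \<Rightarrow> real \<Rightarrow> bool" where
  "lattice_packing n L r \<longleftrightarrow>
     is_lattice n L \<and> r > 0 \<and> (\<forall>x\<in>L. \<forall>y\<in>L. x \<noteq> y \<longrightarrow> l1_dist n x y \<ge> 2 * r)"

text \<open>\<open>(2 * r) ^ n / fact n\<close> is the volume of the cross-polytope of radius \<open>r\<close>.\<close>

definition packing_density :: "nat \<Rightarrow> (nat \<Rightarrow> nat \<Rightarrow> real) \<Rightarrow> real \<Rightarrow> real" where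
  "packing_density n b r = (2 * r) ^ n / (fact n * lattice_det n b)"

definition next_prime :: "nat \<Rightarrow> nat" where
  "next_prime n = (LEAST p. prime p \<and> p > n)"


section \<open>Algorithms and their running time\<close>

text \<open>
  Algorithms are programs of a random access machine, written with structured control flow.
  The memory consists of integer arrays, \<open>m a k\<close> being entry \<open>k\<close> of array \<open>a\<close>; the arrays that
  a program uses are fixed in its text, the entries are computed. The only arithmetic is addition
  and subtraction, and every operation has unit cost. In time \<open>T\<close> a fixed program can then only
  build integers of \<open>O(T)\<close> bits more than its input and its constants have, so that running times
  are polynomially related to those of Turing machines. (With multiplication at unit cost, this
  would fail.)
\<close>

type_synonym mem = "nat \<Rightarrow> int \<Rightarrow> int"

datatype aexp = Num int | Get nat aexp | Plus aexp aexp | Minus aexp aexp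

datatype bexp = Less aexp aexp

datatype com =
    Skip
  | Assign nat aexp aexp   \<comment> \<open>\<open>Assign a i e\<close>: entry \<open>i\<close> of array \<open>a\<close> becomes \<open>e\<close>\<close>
  | Seq com com
  | If bexp com com
  | While bexp com

fun aval :: "aexp \<Rightarrow> mem \<Rightarrow> int" where
  "aval (Num z) m = z"
| "aval (Get a e) m = m a (aval e m)"
| "aval (Plus e f) m = aval e m + aval f m"
| "aval (Minus e f) m = aval e m - aval f m"

fun acost :: "aexp \<Rightarrow> nat" where
  "acost (Num z) = 1"
| "acost (Get a e) = 1 + acost e"
| "acost (Plus e f) = 1 + acost e + acost f"
| "acost (Minus e f) = 1 + acost e + acost f"

fun bval :: "bexp \<Rightarrow> mem \<Rightarrow> bool" where
  "bval (Less e f) m \<longleftrightarrow> aval e m < aval f m"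

fun bcost :: "bexp \<Rightarrow> nat" where
  "bcost (Less e f) = 1 + acost e + acost f"

text \<open>\<open>runs c m T m'\<close>: started in memory \<open>m\<close>, the program \<open>c\<close> halts after \<open>T\<close> steps in memory
  \<open>m'\<close>.\<close>

inductive runs :: "com \<Rightarrow> mem \<Rightarrow> nat \<Rightarrow> mem \<Rightarrow> bool" where
  Skip: "runs Skip m 1 m"
| Assign: "runs (Assign a i e) m (1 + acost i + acost e) (m(a := (m a)(aval i m := aval e m)))"
| Seq: "runs c1 m T1 m1 \<Longrightarrow> runs c2 m1 T2 m2 \<Longrightarrow> runs (Seq c1 c2) m (T1 + T2) m2"
| IfTrue: "bval b m \<Longrightarrow> runs c1 m T m' \<Longrightarrow> runs (If b c1 c2) m (1 + bcost b + T) m'"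
| IfFalse: "\<not> bval b m \<Longrightarrow> runs c2 m T m' \<Longrightarrow> runs (If b c1 c2) m (1 + bcost b + T) m'"
| WhileFalse: "\<not> bval b m \<Longrightarrow> runs (While b c) m (1 + bcost b) m"
| WhileTrue: "bval b m \<Longrightarrow> runs c m T1 m1 \<Longrightarrow> runs (While b c) m1 T2 m2 \<Longrightarrow>
    runs (While b c) m (1 + bcost b + T1 + T2) m2"

text \<open>The input \<open>n\<close> is given in entry \<open>0\<close> of array \<open>0\<close>, all other entries being \<open>0\<close>.
  The output is a list of \<open>n\<close> vectors with \<open>n\<close> integer coordinates each, which is read off from
  array \<open>1\<close> in row-major order. Since packings may be rescaled without changing their density,
  integer coordinates are as good as rational ones.\<close>

definition input_mem :: "nat \<Rightarrow> mem" where
  "input_mem n = (\<lambda>a k. if a = 0 \<and> k = 0 then int n else 0)"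

definition output_vectors :: "nat \<Rightarrow> mem \<Rightarrow> nat \<Rightarrow> nat \<Rightarrow> real" where
  "output_vectors n m i j = (if i < n \<and> j < n then of_int (m 1 (int (i * n + j))) else 0)"

end

theory Submission
  imports Defs "HOL-Number_Theory.Cong"
begin

text \<open>
  Let \<open>p\<close> be the least prime above \<open>n\<close>. If an integer vector \<open>x\<close> satisfies \<open>\<Sum> x\<^sub>i = 0\<close> mod \<open>2 t\<close> and
  \<open>\<Sum> x\<^sub>i i\<^sup>k = 0\<close> mod \<open>p\<close> for \<open>1 \<le> k < t\<close>, and its \<open>l\<^sub>1\<close> norm is below \<open>2 t\<close>, then its positive and its
  negative part have the same weight \<open>w < t\<close>, and by Newton's identities modulo \<open>p\<close> they are the
  multisets of roots of the same polynomial of degree \<open>w\<close>; as they are disjoint, \<open>x = 0\<close>. Such vectors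
  include the multiples \<open>d\<^sub>i (X - 1)\<^sup>i\<close> of signed rows of Pascal's triangle, where \<open>d\<^sub>0 = 2 t\<close>,
  \<open>d\<^sub>i = p\<close> for \<open>0 < i < t\<close>, and \<open>d\<^sub>i = 1\<close> for \<open>i \<ge> t\<close>. These rows form a triangular matrix of
  determinant \<open>2 t p\<^bsup>t - 1\<^esup>\<close>, which is computed by additions and subtractions alone.

  Taking \<open>2 t\<close> instead of \<open>p\<close> as the first modulus matters: with \<open>p\<close> the lattice would contain the
  vectors \<open>p e\<^sub>i\<close>, which are too short when \<open>p < 2 t\<close>, and for \<open>n = 2\<close> and \<open>n = 4\<close> the maximum in the
  theorem is attained at such a \<open>t\<close>. With \<open>2 t\<close>, the density at the best \<open>t\<close> is at least the claimed
  maximum for every \<open>n\<close>, and a smaller radius gives equality. That \<open>p\<close> is polynomially bounded in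
  \<open>n\<close> follows from \<open>Lcm {1..N} \<le> N\<^bsup>\<pi>(N)\<^esup>\<close>.
\<close>

section \<open>A polynomial bound on the next prime\<close>

lemma prime_next_prime: "prime (next_prime n)" and next_prime_gt: "n < next_prime n"
  and next_prime_le: "prime p \<Longrightarrow> n < p \<Longrightarrow> next_prime n \<le> p"
proof -
  have "\<exists>p. prime p \<and> p > n" using bigger_prime by blast
  from LeastI_ex[OF this] show "prime (next_prime n)" "n < next_prime n"
    unfolding next_prime_def by auto
  show "prime p \<Longrightarrow> n < p \<Longrightarrow> next_prime n \<le> p"
    unfolding next_prime_def by (rule Least_le) simp
qed

text \<open>The numbers \<open>1 / (k * ((k + l) choose k))\<close> form the Leibniz triangle: the entry for \<open>(k, l + 1)\<close>
  is the difference of those for \<open>(k, l)\<close> and \<open>(k + 1, l)\<close>. So a common multiple of the denominators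
  for \<open>l = 0\<close> clears all of them.\<close>

lemma mult_binomial_dvd_Lcm:
  "1 \<le> k \<Longrightarrow> k + l \<le> N \<Longrightarrow> k * ((k + l) choose k) dvd Lcm {1..N::nat}"
proof (induction l arbitrary: k)
  case 0
  then show ?case by (auto intro: dvd_Lcm)
next
  case (Suc l)
  define L where "L = Lcm {1..N}"
  obtain a where a: "L = k * ((k + l) choose k) * a"
    using Suc.IH[of k] Suc.prems unfolding L_def by auto
  obtain b where b: "L = Suc k * ((Suc k + l) choose Suc k) * b"
    using Suc.IH[of "Suc k"] Suc.prems unfolding L_def by fastforce
  define C where "C = (k + l) choose k"
  define D where "D = (Suc (k + l)) choose k"
  define E where "E = (Suc (k + l)) choose Suc k"
  have DE: "Suc k * E = Suc (k + l) * C" unfolding C_def E_def by (rule Suc_times_binomial_eq[symmetric, simplified mult.commute])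
  have DD: "Suc l * D = Suc (k + l) * C"
  proof -
    have "Suc (k + l) choose k = Suc (k + l) choose Suc l"
      by (subst binomial_symmetric) auto
    moreover have "(k + l) choose k = (k + l) choose l"
      by (subst binomial_symmetric) auto
    ultimately show ?thesis unfolding D_def C_def
      using Suc_times_binomial_eq[of "k + l" l] by (simp add: mult.commute)
  qed
  have Cpos: "C > 0" by (simp add: C_def)
  have La: "int L = int k * int C * int a" using a by (simp add: C_def)
  have "L = Suc (k + l) * C * b" using b DE by (simp only: E_def add_Suc)
  then have Lb: "int L = int (Suc (k + l)) * int C * int b" by (simp only: of_nat_mult)
  \<comment> \<open>\<open>a\<close> and \<open>b\<close> are the cofactors of \<open>L\<close> at
    (k, l) and (k + 1, l), so by the Leibniz rule their difference is the cofactor at (k, l + 1).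
    The factor \<open>Suc l\<close> is inserted to use \<open>DD\<close> and then cancelled.\<close>
  have "int k * int D * (int a - int b) = int L"
  proof -
    have *: "int k * int a = int (Suc (k + l)) * int b"
    proof -
      have "int C * (int k * int a) = int C * (int (Suc (k + l)) * int b)"
        using La Lb by (simp only: mult_ac)
      then show ?thesis using Cpos by (subst (asm) mult_cancel_left) linarith
    qed
    have "int (Suc l) * (int k * int D * (int a - int b)) = int k * (int (Suc (k+l)) * int C) * (int a - int b)"
      proof -
      have "int (Suc l) * int D = int (Suc (k + l)) * int C" using DD by (simp only: flip: of_nat_mult)
      then have "int k * (int (Suc l) * int D) * (int a - int b) = int k * (int (Suc (k + l)) * int C) * (int a - int b)"
        by (simp only:)
      then show ?thesis by (simp only: mult_ac)
    qed
    also have "\<dots> = int (Suc (k+l)) * (int k * int C * int a) - int k * (int (Suc (k+l)) * int C * int b)"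
      by (simp add: algebra_simps)
    also have "\<dots> = int (Suc (k+l)) * int L - int k * int L" by (simp only: La[symmetric] Lb[symmetric])
    also have "\<dots> = int (Suc l) * int L" by (simp add: algebra_simps)
    finally show ?thesis by (simp only: mult_cancel_left) simp
  qed
  then have "int (k * D) dvd int L" by (metis dvd_triv_left of_nat_mult)
  then have "k * D dvd L" by (simp only: int_dvd_int_iff)
  then show ?case by (simp add: D_def L_def)
qed

text \<open>The multiplicity of a prime in an \<open>lcm\<close> is the maximum of its
  multiplicities in the arguments, so a single element carries the whole power.\<close>

lemma prime_power_dvd_Lcm:
  assumes "finite A" "prime p" "p ^ k dvd Lcm A" "k > 0" "0 \<notin> A"
  shows "\<exists>a\<in>A. p ^ k dvd (a::nat)"
  using assms
proof (induction A rule: finite_induct)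
  case empty
  then show ?case using prime_gt_1_nat[of p] by simp
next
  case (insert a A)
  have "Lcm A \<noteq> 0" using insert by (auto simp: Lcm_0_iff)
  moreover have "a \<noteq> 0" using insert by auto
  ultimately have "multiplicity p (lcm a (Lcm A)) = max (multiplicity p a) (multiplicity p (Lcm A))"
    using multiplicity_lcm[OF _ _ insert.prems(1)] by simp
  moreover have "multiplicity p (lcm a (Lcm A)) \<ge> k"
    using insert.prems \<open>Lcm A \<noteq> 0\<close> \<open>a \<noteq> 0\<close> prime_gt_1_nat[of p]
    by (intro multiplicity_geI) auto
  ultimately have "multiplicity p a \<ge> k \<or> multiplicity p (Lcm A) \<ge> k" by auto
  then have "p ^ k dvd a \<or> p ^ k dvd Lcm A" using multiplicity_dvd' by blast
  then show ?case using insert by auto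
qed

text \<open>Every prime power in the factorization of the \<open>Lcm\<close> already divides some
  number up to \<open>N\<close>, hence is at most \<open>N\<close>; there is one such power for each
  prime factor.\<close>

lemma Lcm_le_power_primes:
  fixes N :: nat
  shows "Lcm {1..N} \<le> N ^ card {p. prime p \<and> p \<le> N}"
proof (cases "N = 0")
  case True
  have none: "{p::nat. p = 0 \<and> prime p} = {}" by auto
  show ?thesis unfolding True by (simp add: none)
next
  case False
  define L where "L = Lcm {1..N}"
  have L0: "L \<noteq> 0" by (simp add: L_def Lcm_0_iff)
  have *: "p ^ multiplicity p L \<le> N \<and> p \<le> N" if "p \<in> prime_factors L" for p
  proof -
    have p: "prime p" "multiplicity p L > 0"
      using that L0 by (auto simp: prime_factors_multiplicity)
    have "p ^ multiplicity p L dvd L" by (rule multiplicity_dvd)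
    then obtain a where a: "a \<in> {1..N}" "p ^ multiplicity p L dvd a"
      using prime_power_dvd_Lcm[of "{1..N}" p "multiplicity p L"] p unfolding L_def by auto
    then have le: "p ^ multiplicity p L \<le> N" using dvd_imp_le[OF a(2)] by simp
    moreover have "p \<le> p ^ multiplicity p L"
      using p prime_gt_1_nat[of p] by (simp add: self_le_power)
    ultimately show ?thesis by simp
  qed
  have "L = (\<Prod>p\<in>prime_factors L. p ^ multiplicity p L)"
    using prime_factorization_nat[of L] L0 by simp
  also have "\<dots> \<le> (\<Prod>p\<in>prime_factors L. N)" by (intro prod_mono) (use * in auto)
  also have "\<dots> = N ^ card (prime_factors L)" by simp
  also have "\<dots> \<le> N ^ card {p. prime p \<and> p \<le> N}"
    using False * by (intro power_increasing card_mono) auto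
  finally show ?thesis by (simp add: L_def)
qed

text \<open>If no prime lay in the range from \<open>n + 1\<close> to \<open>2 * m\<close>, at most
  \<open>n\<close> primes would lie below, and the \<open>Lcm\<close> would be at most
  \<open>(2 * m) ^ n\<close>. But it is at least the central binomial coefficient, of size about
  \<open>4 ^ m\<close>, which is larger for \<open>m = (n + 1)\<^sup>2\<close>.\<close>

lemma next_prime_bound: "next_prime n \<le> 2 * (n + 1)\<^sup>2"
proof (rule ccontr)
  assume big: "\<not> ?thesis"
  define k where "k = n + 1"
  define m where "m = k\<^sup>2"
  have no: "p \<le> n" if "prime p" "p \<le> 2 * m" for p
    using that next_prime_le[of p n] big unfolding m_def k_def by force
  have m: "m \<ge> 1" by (simp add: m_def k_def)
  have "4 ^ m / (2 * real m) \<le> real ((2 * m) choose m)"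
    using central_binomial_lower_bound[of m] m by simp
  also have "(2 * m) choose m \<le> m * ((m + m) choose m)" using m by (simp add: mult_2)
  also have "\<dots> \<le> Lcm {1..2 * m}"
    using mult_binomial_dvd_Lcm[of m m "2 * m"] m by (intro dvd_imp_le) (auto simp: Lcm_0_iff intro!: Nat.gr0I)
  also have "\<dots> \<le> (2 * m) ^ card {p. prime p \<and> p \<le> 2 * m}" by (rule Lcm_le_power_primes)
  also have "\<dots> \<le> (2 * m) ^ n"
  proof (intro power_increasing)
    have "card {p. prime p \<and> p \<le> 2 * m} \<le> card {1..n}"
      using no prime_ge_1_nat by (intro card_mono) auto
    then show "card {p. prime p \<and> p \<le> 2 * m} \<le> n" by simp
  qed (use m in auto)
  finally have "real (4 ^ m) \<le> real ((2 * m) ^ n * (2 * m))"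
    using m by (simp add: divide_simps)
  then have "4 ^ m \<le> (2 * m) ^ k" unfolding of_nat_le_iff by (simp add: k_def mult.commute)
  \<comment> \<open>The crude bound \<open>k \<le> 2 ^ n\<close> suffices: the exponent of 2 becomes
    \<open>(2 * n + 1) * k\<close>, which falls short of \<open>2 * m = (2 * n + 2) * k\<close> by
    \<open>k\<close>.\<close>
  also have "(2 * m) ^ k \<le> (2 * (2 ^ n)\<^sup>2) ^ k"
  proof (intro power_mono mult_left_mono)
    have "k \<le> 2 ^ n" using less_exp[of n] unfolding k_def by linarith
    then show "m \<le> (2 ^ n)\<^sup>2" unfolding m_def by (rule power_mono) simp
  qed auto
  also have "2 * (2 ^ n)\<^sup>2 = (2::nat) ^ (2 * n + 1)" by (simp add: power_even_eq)
  also have "\<dots> ^ k = 2 ^ ((2 * n + 1) * k)" by (rule power_mult[symmetric])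
  also have "\<dots> < 2 ^ (2 * m)"
    by (intro power_strict_increasing) (auto simp: m_def k_def power2_eq_square)
  also have "\<dots> = (4::nat) ^ m" by (simp add: power_mult)
  finally show False by simp
qed

section \<open>The minimum distance\<close>

text \<open>The roots are inverted so that the logarithmic derivative is the generating function of the
  power sums.\<close>

definition locator :: "nat \<Rightarrow> (nat \<Rightarrow> nat) \<Rightarrow> int fps" where
  "locator n a = (\<Prod>i<n. (1 - fps_const (int i) * fps_X) ^ a i)"

definition power_sum :: "nat \<Rightarrow> (nat \<Rightarrow> nat) \<Rightarrow> nat \<Rightarrow> int" where
  "power_sum n a k = (\<Sum>i<n. int (a i) * int i ^ k)"

lemma geometric_fps: "(1 - fps_const c * fps_X) * Abs_fps (\<lambda>k. c ^ k) = (1 :: int fps)"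
proof (rule fps_ext)
  fix k show "((1 - fps_const c * fps_X) * Abs_fps (\<lambda>k. c ^ k)) $ k = 1 $ k"
    by (cases k) (simp_all add: left_diff_distrib mult.assoc)
qed

text \<open>The factor with index \<open>i\<close> contributes \<open>- a i * i / (1 - i X)\<close>
  to the logarithmic derivative, and the geometric series turns this into the terms
  \<open>- a i * i ^ Suc k\<close> of the power sums.\<close>

lemma fps_deriv_locator:
  "fps_deriv (locator n a) = - locator n a * Abs_fps (\<lambda>k. power_sum n a (Suc k))"
proof (induction n)
  case 0
  then show ?case by (simp add: locator_def power_sum_def fps_eq_iff)
next
  case (Suc n)
  define v where "v = fps_const (int n)"
  define u where "u = 1 - v * fps_X"
  define G where "G = Abs_fps (\<lambda>k. int n ^ k)"
  have uG: "u * G = 1" unfolding u_def v_def G_def by (rule geometric_fps)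
  have du: "fps_deriv u = - v" by (simp add: u_def v_def)
  have dpow: "fps_deriv (u ^ a n) = - (u ^ a n) * (of_nat (a n) * v * G)"
  proof (cases "a n")
    case (Suc b)
    have "fps_deriv (u ^ a n) = of_nat (a n) * (- v) * u ^ b"
      unfolding fps_deriv_power du Suc by (simp only: diff_Suc_1 fps_of_nat)
    \<comment> \<open>Differentiation lowers the exponent of \<open>u\<close> by one; inserting
      \<open>u * G = 1\<close> restores it.\<close>
    also have "\<dots> = of_nat (a n) * (- v) * u ^ b * (u * G)" by (simp add: uG)
    also have "\<dots> = - (u ^ a n) * (of_nat (a n) * v * G)"
      unfolding Suc power_Suc by (simp add: mult_ac)
    finally show ?thesis .
  qed simp
  have ps: "Abs_fps (\<lambda>k. power_sum (Suc n) a (Suc k)) =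
      Abs_fps (\<lambda>k. power_sum n a (Suc k)) + of_nat (a n) * v * G"
    by (rule fps_ext)
      (simp add: power_sum_def G_def v_def mult.assoc fps_of_nat[symmetric] fps_mult_left_const_nth del: fps_of_nat)
  have loc: "locator (Suc n) a = locator n a * u ^ a n" by (simp add: locator_def u_def v_def)
  show ?case unfolding loc ps fps_deriv_mult dpow Suc.IH by (simp add: algebra_simps)
qed

lemma newton_identity:
  "int (Suc k) * locator n a $ Suc k = - (\<Sum>i\<le>k. locator n a $ i * power_sum n a (Suc (k - i)))"
proof -
  have "int (Suc k) * locator n a $ Suc k = fps_deriv (locator n a) $ k" by simp
  also have "\<dots> = - (\<Sum>i\<le>k. locator n a $ i * power_sum n a (Suc (k - i)))"
    unfolding fps_deriv_locator by (simp add: fps_mult_nth atLeast0AtMost sum_negf)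
  finally show ?thesis .
qed

lemma locator_nth_0: "locator n a $ 0 = 1"
  by (induction n) (simp_all add: locator_def fps_power_zeroth)

text \<open>Newton's identity gives \<open>k\<close> times coefficient \<open>k\<close> in terms of
  lower coefficients and the power sums up to order \<open>k\<close>; for
  \<open>0 < k < t \<le> p\<close> the factor \<open>k\<close> is invertible modulo
  \<open>p\<close>.\<close>

lemma locator_cong:
  assumes p: "prime p" and tp: "t \<le> p"
    and ps: "\<And>k. 1 \<le> k \<Longrightarrow> k < t \<Longrightarrow> [power_sum n a k = power_sum n b k] (mod int p)"
  shows "k < t \<Longrightarrow> [locator n a $ k = locator n b $ k] (mod int p)"
proof (induction k rule: less_induct)
  case (less k)
  show ?case
  proof (cases k)
    case 0
    then show ?thesis by (simp add: locator_nth_0)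
  next
    case (Suc j)
    have "[int k * locator n a $ k = int k * locator n b $ k] (mod int p)"
      unfolding Suc newton_identity
      using less Suc ps by (intro cong_uminus cong_sum cong_mult) auto
    moreover have "coprime (int k) (int p)"
      using prime_imp_coprime[OF p, of k] less.prems Suc tp
      by (simp add: coprime_commute nat_dvd_not_less del: of_nat_Suc)
    ultimately show ?thesis using cong_mult_lcancel by blast
  qed
qed

text \<open>\<open>locator\<close> is the reversal of the product polynomial, whose degree is the
  total weight. Only coefficients up to that weight occur, so a weight below \<open>t\<close> puts
  all of them within reach of \<open>locator_cong\<close>.\<close>

lemma prod_eq_locator_sum:
  "(\<Prod>i<n. (x - int i) ^ a i) = (\<Sum>k\<le>(\<Sum>i<n. a i). locator n a $ ((\<Sum>i<n. a i) - k) * x ^ k)"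
proof -
  define A where "A = (\<Prod>i<n. [:- int i, 1:] ^ (a i))"
  define w where "w = (\<Sum>i<n. a i)"
  \<comment> \<open>For \<open>i = 0\<close> the reflection of \<open>X\<close> is the constant 1,
    in accordance with the factor \<open>1 - 0 X\<close>.\<close>
  have r: "reflect_poly [:- int i, 1:] = [:1, - int i:]" for i
    by (cases "i = 0") (auto simp: reflect_poly_pCons reflect_poly_pCons')
  have f: "fps_of_poly [:1, - int i:] = 1 - fps_const (int i) * fps_X" for i
    by (simp add: fps_of_poly_pCons flip: fps_const_neg)
  have loc: "locator n a = fps_of_poly (reflect_poly A)"
    unfolding locator_def A_def reflect_poly_prod reflect_poly_power r fps_of_poly_prod fps_of_poly_power f ..
  have deg: "degree A = w"
    unfolding A_def w_def by (subst degree_prod_eq_sum_degree) (auto simp: degree_power_eq)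
  have "(\<Prod>i<n. (x - int i) ^ a i) = poly A x" by (simp add: A_def poly_prod)
  also have "\<dots> = (\<Sum>k\<le>w. coeff A k * x ^ k)" by (simp add: poly_altdef deg)
  also have "\<dots> = (\<Sum>k\<le>w. locator n a $ (w - k) * x ^ k)"
    by (intro sum.cong) (auto simp: loc deg coeff_reflect_poly)
  finally show ?thesis by (simp add: w_def)
qed

text \<open>The two products agree modulo \<open>p\<close> at every argument. At some
  \<open>j\<close> with \<open>a j > 0\<close> the first one vanishes, so \<open>p\<close> divides
  \<open>j - i\<close> for some \<open>i\<close> with \<open>b i > 0\<close>. Disjointness excludes
  \<open>i = j\<close>, and \<open>n \<le> p\<close> excludes every other \<open>i\<close>.\<close>

lemma power_sums_determine:
  assumes p: "prime p" and np: "n \<le> p" and tp: "t \<le> p"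
    and ps: "\<And>k. 1 \<le> k \<Longrightarrow> k < t \<Longrightarrow> [power_sum n a k = power_sum n b k] (mod int p)"
    and wa: "(\<Sum>i<n. a i) = w" and wb: "(\<Sum>i<n. b i) = w" and wt: "w < t"
    and disj: "\<And>i. i < n \<Longrightarrow> a i = 0 \<or> b i = 0"
  shows "w = 0"
proof (rule ccontr)
  assume "w \<noteq> 0"
  obtain j where j: "j < n" "a j \<noteq> 0"
  proof (rule ccontr)
    assume "\<not> thesis"
    then have "(\<Sum>i<n. a i) = 0" using that by (intro sum.neutral) auto
    then show False using wa \<open>w \<noteq> 0\<close> by simp
  qed
  have bj: "b j = 0" using disj[OF j(1)] j(2) by simp
  have "[(\<Prod>i<n. (int j - int i) ^ a i) = (\<Prod>i<n. (int j - int i) ^ b i)] (mod int p)"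
    unfolding prod_eq_locator_sum wa wb
    using wt by (intro cong_sum cong_mult locator_cong[OF p tp ps]) auto
  moreover have "(\<Prod>i<n. (int j - int i) ^ a i) = 0"
    using j by (intro prod_zero bexI[of _ j]) auto
  ultimately have "[(\<Prod>i<n. (int j - int i) ^ b i) = 0] (mod int p)"
    using cong_sym by simp
  then have "int p dvd (\<Prod>i<n. (int j - int i) ^ b i)" by (simp only: cong_0_iff)
  moreover have "prime (int p)" using p by simp
  ultimately obtain i where i: "i < n" "int p dvd (int j - int i) ^ b i"
    using prime_dvd_prod_iff[of "{..<n}" "int p"] by auto
  have "i \<noteq> j" using i bj p by auto
  moreover have "int p dvd int j - int i" using i(2) \<open>prime (int p)\<close> prime_dvd_power by blast
  ultimately show False using i(1) j(1) np zdvd_imp_le[of "int p" "\<bar>int j - int i\<bar>"] by auto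
qed

text \<open>A sum divisible by \<open>2 * t\<close> and smaller than that in absolute value is zero.
  So the positive part \<open>a\<close> and the negative part \<open>b\<close> have equal weights,
  each below \<open>t\<close>, and their power sums agree modulo \<open>p\<close>.\<close>

lemma l1_norm_ge:
  fixes x :: "nat \<Rightarrow> int"
  assumes p: "prime p" and np: "n \<le> p" and tp: "t \<le> p"
    and sum0: "int (2 * t) dvd (\<Sum>i<n. x i)"
    and ps: "\<And>k. 1 \<le> k \<Longrightarrow> k < t \<Longrightarrow> int p dvd (\<Sum>i<n. x i * int i ^ k)"
    and nz: "\<exists>i<n. x i \<noteq> 0"
  shows "int (2 * t) \<le> (\<Sum>i<n. \<bar>x i\<bar>)"
proof (rule ccontr)
  assume less: "\<not> ?thesis"
  define a where "a i = nat (x i)" for i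
  define b where "b i = nat (- x i)" for i
  have xab: "x i = int (a i) - int (b i)" "\<bar>x i\<bar> = int (a i) + int (b i)" for i
    by (auto simp: a_def b_def)
  have "(\<Sum>i<n. x i) = 0"
  proof (rule ccontr)
    assume "(\<Sum>i<n. x i) \<noteq> 0"
    then have "int (2 * t) \<le> \<bar>\<Sum>i<n. x i\<bar>"
      using sum0 by (intro zdvd_imp_le) auto
    also have "\<dots> \<le> (\<Sum>i<n. \<bar>x i\<bar>)" by (rule sum_abs)
    finally show False using less by simp
  qed
  then have ab: "(\<Sum>i<n. a i) = (\<Sum>i<n. b i)"
    by (simp add: xab sum_subtractf flip: of_nat_sum)
  have "(\<Sum>i<n. \<bar>x i\<bar>) = int (\<Sum>i<n. a i) + int (\<Sum>i<n. b i)"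
    by (simp only: xab(2) sum.distrib of_nat_sum)
  then have "int (2 * (\<Sum>i<n. a i)) < int (2 * t)" using less ab by simp
  then have "2 * (\<Sum>i<n. a i) < 2 * t" by (simp only: of_nat_less_iff)
  then have "(\<Sum>i<n. a i) < t" by simp
  moreover have "[power_sum n a k = power_sum n b k] (mod int p)" if "1 \<le> k" "k < t" for k
    using ps[OF that] by (simp add: cong_iff_dvd_diff power_sum_def xab left_diff_distrib sum_subtractf)
  ultimately have w: "(\<Sum>i<n. a i) = 0"
    using power_sums_determine[OF p np tp, of a b "\<Sum>i<n. a i"] ab
    by (metis (no_types, lifting) a_def b_def nat_eq_iff nat_le_0 neg_le_0_iff_le linear)
  then have "\<forall>i<n. x i = 0" using ab by (simp add: xab)
  then show False using nz by auto
qed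

text \<open>Up to sign this is the \<open>i\<close>-th finite difference of a polynomial of degree
  \<open>k < i\<close>. Absorbing one factor \<open>j\<close> into the binomial coefficient lowers
  \<open>i\<close> and \<open>k\<close> by one; expanding the shifted power then reduces to
  exponents \<open>m \<le> l\<close>, hence the strong induction.\<close>

lemma alternating_binomial_power_sum:
  "k < i \<Longrightarrow> (\<Sum>j\<le>i. (-1) ^ j * int (i choose j) * int j ^ k) = 0"
proof (induction k arbitrary: i rule: less_induct)
  case (less k)
  show ?case
  proof (cases k)
    case 0
    then show ?thesis using choose_alternating_sum[of i, where 'a = int] less.prems by simp
  next
    case (Suc l)
    obtain i' where i': "i = Suc i'" using less.prems by (cases i) auto
    have tm: "(-1) ^ Suc j * int (Suc i' choose Suc j) * int (Suc j) ^ Suc l =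
        - int (Suc i') * ((-1) ^ j * int (i' choose j) * int (Suc j) ^ l)" for j
    proof -
      have "int (Suc j) * int (Suc i' choose Suc j) = int (Suc i') * int (i' choose j)"
        using Suc_times_binomial_eq[of i' j] by (metis mult.commute of_nat_mult)
      moreover have "(-1) ^ Suc j * int (Suc i' choose Suc j) * int (Suc j) ^ Suc l =
          - ((-1) ^ j * int (Suc j) ^ l * (int (Suc j) * int (Suc i' choose Suc j)))"
        by (simp only: power_Suc mult_ac)
      ultimately show ?thesis by (simp only: mult_ac)
    qed
    have "(\<Sum>j\<le>i. (-1) ^ j * int (i choose j) * int j ^ k) =
       (\<Sum>j\<le>i'. (-1) ^ Suc j * int (Suc i' choose Suc j) * int (Suc j) ^ Suc l)"
      unfolding i' Suc by (subst sum.atMost_Suc_shift) simp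
    also have "\<dots> = - int (Suc i') * (\<Sum>j\<le>i'. (-1) ^ j * int (i' choose j) * int (Suc j) ^ l)"
      unfolding tm by (simp only: sum_distrib_left)
    also have "(\<Sum>j\<le>i'. (-1) ^ j * int (i' choose j) * int (Suc j) ^ l) =
       (\<Sum>j\<le>i'. \<Sum>m\<le>l. int (l choose m) * ((-1) ^ j * int (i' choose j) * int j ^ m))"
    proof (intro sum.cong refl)
      fix j
      have "int (Suc j) ^ l = (\<Sum>m\<le>l. int (l choose m) * int j ^ m)"
        using binomial_ring[of "int j" 1 l] by (simp add: add.commute)
      then show "(-1) ^ j * int (i' choose j) * int (Suc j) ^ l =
          (\<Sum>m\<le>l. int (l choose m) * ((-1) ^ j * int (i' choose j) * int j ^ m))"
        by (simp only: sum_distrib_left mult_ac)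
    qed
    also have "\<dots> = (\<Sum>m\<le>l. int (l choose m) * (\<Sum>j\<le>i'. (-1) ^ j * int (i' choose j) * int j ^ m))"
      by (subst sum.swap) (simp only: sum_distrib_left)
    also have "\<dots> = 0" using less.IH less.prems Suc i' by (intro sum.neutral) auto
    finally show ?thesis by simp
  qed
qed

section \<open>Lattices with a triangular basis\<close>

text \<open>Back substitution for the coordinates of \<open>x\<close> with respect to the rows of a triangular \<open>b\<close>.\<close>

function tri_solve :: "nat \<Rightarrow> (nat \<Rightarrow> nat \<Rightarrow> real) \<Rightarrow> (nat \<Rightarrow> real) \<Rightarrow> nat \<Rightarrow> real" where
  "tri_solve n b x j = (x j - (\<Sum>i\<in>{j<..<n}. tri_solve n b x i * b i j)) / b j j"
  by pat_completeness auto
termination by (relation "Wellfounded.measure (\<lambda>(n, b, x, j). n - j)") auto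

declare tri_solve.simps [simp del]

text \<open>The positive diagonal lets the determinant be the product of the diagonal entries
  without an absolute value.\<close>

definition lower_triangular :: "nat \<Rightarrow> (nat \<Rightarrow> nat \<Rightarrow> real) \<Rightarrow> bool" where
  "lower_triangular n b \<longleftrightarrow> (\<forall>i<n. b i i > 0 \<and> (\<forall>j. i < j \<longrightarrow> b i j = 0))"

lemma lower_triangular_sum:
  assumes "lower_triangular n b" "j < n"
  shows "(\<Sum>i<n. c i * b i j) = c j * b j j + (\<Sum>i\<in>{j<..<n}. c i * b i j)"
proof -
  have "(\<Sum>i<n. c i * b i j) = (\<Sum>i\<in>insert j {j<..<n}. c i * b i j)"
    using assms by (intro sum.mono_neutral_right) (auto simp: lower_triangular_def)
  then show ?thesis by simp
qed

lemma tri_solve_unique: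
  assumes b: "lower_triangular n b" and x: "\<And>j. j < n \<Longrightarrow> x j = (\<Sum>i<n. c i * b i j)"
  shows "j < n \<Longrightarrow> tri_solve n b x j = c j"
proof (induction "n - j" arbitrary: j rule: less_induct)
  case less
  have "tri_solve n b x j = (x j - (\<Sum>i\<in>{j<..<n}. c i * b i j)) / b j j"
    by (subst tri_solve.simps, rule arg_cong2[where f = "(/)"], rule arg_cong2[where f = "(-)"])
      (use less in \<open>auto intro!: sum.cong\<close>)
  also have "\<dots> = c j * b j j / b j j"
    using less.prems by (simp add: x lower_triangular_sum[OF b])
  finally show ?case using b less.prems by (auto simp: lower_triangular_def)
qed

lemma tri_solve_sum:
  assumes b: "lower_triangular n b" and "j < n"
  shows "(\<Sum>i<n. tri_solve n b x i * b i j) = x j"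
proof -
  have "b j j \<noteq> 0" using assms by (auto simp: lower_triangular_def)
  then show ?thesis unfolding lower_triangular_sum[OF assms]
    by (subst tri_solve.simps[of n b x j]) simp
qed

text \<open>Back substitution starts at the last index, so coordinate \<open>i\<close> depends only
  on the entries from \<open>i\<close> on. This allows integration over one entry at a time.\<close>

lemma tri_solve_upd: "k < i \<Longrightarrow> tri_solve n b (x(k := y)) i = tri_solve n b x i"
proof (induction "n - i" arbitrary: i rule: less_induct)
  case less
  then show ?case
    by (subst (1 2) tri_solve.simps) (auto intro!: sum.cong arg_cong2[where f = "(/)"])
qed

section \<open>The volume of the fundamental cell\<close>

lemma tri_solve_measurable:
  assumes "{j..<n} \<subseteq> I" "j < n"
  shows "(\<lambda>x. tri_solve n b x j) \<in> borel_measurable (Pi\<^sub>M I (\<lambda>_. lborel))"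
  using assms
proof (induction "n - j" arbitrary: j rule: less_induct)
  case less
  have [measurable]: "(\<lambda>x. tri_solve n b x i) \<in> borel_measurable (Pi\<^sub>M I (\<lambda>_. lborel))"
    if "i \<in> {j<..<n}" for i
    using less that by (intro less.hyps) auto
  have [measurable]: "(\<lambda>x. x j) \<in> borel_measurable (Pi\<^sub>M I (\<lambda>_. lborel))"
    using less.prems measurable_component_singleton[of j I "\<lambda>_. lborel"] by auto
  show ?case by (subst tri_solve.simps) measurable
qed

text \<open>For \<open>k = 0\<close> this is the fundamental cell, given by inequalities on
  coordinates in place of an image, which makes measurability direct. Larger \<open>k\<close> serve
  the induction over the dimension.\<close>

definition solved_cell :: "nat \<Rightarrow> (nat \<Rightarrow> nat \<Rightarrow> real) \<Rightarrow> nat \<Rightarrow> (nat \<Rightarrow> real) set" where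
  "solved_cell n b k = {x \<in> space (Pi\<^sub>M {k..<n} (\<lambda>_. lborel)).
     \<forall>i\<in>{k..<n}. 0 \<le> tri_solve n b x i \<and> tri_solve n b x i < 1}"

lemma sets_solved_cell: "solved_cell n b k \<in> sets (Pi\<^sub>M {k..<n} (\<lambda>_. lborel))"
proof -
  have [measurable]: "(\<lambda>x. tri_solve n b x i) \<in> borel_measurable (Pi\<^sub>M {k..<n} (\<lambda>_. lborel))"
    if "i \<in> {k..<n}" for i
    using that by (intro tri_solve_measurable) auto
  show ?thesis unfolding solved_cell_def by measurable
qed

text \<open>By Fubini: once the later entries are fixed, the condition on coordinate
  \<open>k\<close> confines entry \<open>k\<close> to a half-open interval of length
  \<open>b k k\<close>. Its left end \<open>s x\<close> is the contribution of the later rows, and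
  it does not affect the length.\<close>

lemma emeasure_solved_cell:
  assumes b: "lower_triangular n b" and "k \<le> n"
  shows "emeasure (Pi\<^sub>M {k..<n} (\<lambda>_. lborel)) (solved_cell n b k) = (\<Prod>i\<in>{k..<n}. ennreal (b i i))"
  using \<open>k \<le> n\<close>
proof (induction rule: inc_induct)
  case base
  have "solved_cell n b n = space (Pi\<^sub>M {} (\<lambda>_. lborel))" by (auto simp: solved_cell_def)
  then show ?case by (simp add: space_PiM)
next
  case (step k)
  interpret product_sigma_finite "\<lambda>_::nat. lborel :: real measure" by standard
  have ins: "{k..<n} = insert k {Suc k..<n}" using step by auto
  have d: "b k k > 0" using b step by (auto simp: lower_triangular_def)
  define s where "s x = (\<Sum>i\<in>{k<..<n}. tri_solve n b x i * b i k)" for x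
  have "emeasure (Pi\<^sub>M {k..<n} (\<lambda>_. lborel)) (solved_cell n b k) =
      (\<integral>\<^sup>+ x. indicator (solved_cell n b k) x \<partial>Pi\<^sub>M {k..<n} (\<lambda>_. lborel))"
    by (rule nn_integral_indicator[symmetric, OF sets_solved_cell])
  also have "\<dots> = (\<integral>\<^sup>+ x. (\<integral>\<^sup>+ y. indicator (solved_cell n b k) (x(k := y)) \<partial>lborel) \<partial>Pi\<^sub>M {Suc k..<n} (\<lambda>_. lborel))"
    unfolding ins using sets_solved_cell[of n b k]
    by (intro product_nn_integral_insert) (auto simp: ins)
  also have "\<dots> = (\<integral>\<^sup>+ x. indicator (solved_cell n b (Suc k)) x * ennreal (b k k) \<partial>Pi\<^sub>M {Suc k..<n} (\<lambda>_. lborel))"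
  proof (intro nn_integral_cong)
    fix x :: "nat \<Rightarrow> real" assume x: "x \<in> space (Pi\<^sub>M {Suc k..<n} (\<lambda>_. lborel))"
    have "x(k := y) \<in> solved_cell n b k \<longleftrightarrow> x \<in> solved_cell n b (Suc k) \<and> y \<in> {s x..<s x + b k k}" for y
    proof -
      have "x(k := y) \<in> space (Pi\<^sub>M {k..<n} (\<lambda>_. lborel))"
        using x unfolding ins by (auto simp: space_PiM PiE_def extensional_def)
      moreover have "tri_solve n b (x(k := y)) k = (y - s x) / b k k"
        by (subst tri_solve.simps) (simp add: s_def tri_solve_upd)
      moreover have "0 \<le> (y - s x) / b k k \<and> (y - s x) / b k k < 1 \<longleftrightarrow> y \<in> {s x..<s x + b k k}"
        using d by (auto simp: field_simps)
      ultimately show ?thesis using x by (auto simp: solved_cell_def ins tri_solve_upd)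
    qed
    then have "indicator (solved_cell n b k) (x(k := y)) =
        (indicator (solved_cell n b (Suc k)) x * indicator {s x..<s x + b k k} y :: ennreal)" for y
      by (auto simp: indicator_def)
    then show "(\<integral>\<^sup>+ y. indicator (solved_cell n b k) (x(k := y)) \<partial>lborel) =
        indicator (solved_cell n b (Suc k)) x * ennreal (b k k)"
      using d by (simp add: nn_integral_cmult)
  qed
  also have "\<dots> = emeasure (Pi\<^sub>M {Suc k..<n} (\<lambda>_. lborel)) (solved_cell n b (Suc k)) * ennreal (b k k)"
    using sets_solved_cell[of n b "Suc k"] by (simp add: nn_integral_multc)
  also have "\<dots> = (\<Prod>i\<in>{k..<n}. ennreal (b i i))"
    using step by (simp add: ins mult.commute)
  finally show ?case .
qed

lemma lattice_det_lower_triangular: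
  assumes b: "lower_triangular n b"
  shows "lattice_det n b = (\<Prod>i<n. b i i)"
proof -
  have "(\<lambda>x. restrict x {..<n}) ` fundamental_cell n b = solved_cell n b 0"
  proof safe
    fix x assume "x \<in> fundamental_cell n b"
    then obtain c where c: "x = (\<lambda>j. \<Sum>i<n. c i * b i j)" "\<And>i. i < n \<Longrightarrow> 0 \<le> c i \<and> c i < 1"
      by (auto simp: fundamental_cell_def)
    have "tri_solve n b (restrict x {..<n}) i = c i" if "i < n" for i
      using that by (intro tri_solve_unique[OF b]) (auto simp: c)
    then show "restrict x {..<n} \<in> solved_cell n b 0"
      using c(2) by (auto simp: solved_cell_def space_PiM lessThan_atLeast0)
  next
    fix x assume x: "x \<in> solved_cell n b 0"
    define y where "y j = (\<Sum>i<n. tri_solve n b x i * b i j)" for j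
    have "x = restrict y {..<n}"
      using x by (auto simp: solved_cell_def space_PiM y_def tri_solve_sum[OF b] PiE_def extensional_def)
    moreover have "y \<in> fundamental_cell n b"
      using x unfolding fundamental_cell_def y_def[abs_def]
      by (auto simp: solved_cell_def intro!: exI[of _ "tri_solve n b x"])
    ultimately show "x \<in> (\<lambda>x. restrict x {..<n}) ` fundamental_cell n b" by blast
  qed
  moreover have "emeasure (Pi\<^sub>M {..<n} (\<lambda>_. lborel)) (solved_cell n b 0) = ennreal (\<Prod>i<n. b i i)"
    using emeasure_solved_cell[OF b, of 0] prod_ennreal[of "{..<n}" "\<lambda>i. b i i"] b
    by (simp add: lessThan_atLeast0 lower_triangular_def less_imp_le)
  moreover have "(\<Prod>i<n. b i i) \<ge> 0"
    using b by (intro prod_nonneg) (auto simp: lower_triangular_def less_imp_le)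
  ultimately show ?thesis by (simp add: lattice_det_def volume_def measure_def)
qed

section \<open>The lattice axioms\<close>

lemma lin_indep_lower_triangular:
  assumes b: "lower_triangular n b"
  shows "lin_indep n b"
  unfolding lin_indep_def
proof (intro allI impI)
  fix c :: "nat \<Rightarrow> real" and i
  assume c: "\<forall>j<n. (\<Sum>i<n. c i * b i j) = 0" and i: "i < n"
  have "tri_solve n b (\<lambda>_. 0) i = c i" using c i by (intro tri_solve_unique[OF b]) auto
  moreover have "tri_solve n b (\<lambda>_. 0) i = (\<lambda>_. 0) i" using i by (intro tri_solve_unique[OF b]) auto
  ultimately show "c i = 0" by simp
qed

text \<open>The open cube of half-width 1 about an integer point contains no other integer point. It
  constrains finitely many entries; all others vanish on \<open>L\<close>.\<close>

lemma discrete_Euclidean_space_Ints: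
  assumes L: "L \<subseteq> topspace (Euclidean_space n)" and int: "\<And>x j. x \<in> L \<Longrightarrow> x j \<in> \<int>"
  shows "subtopology (Euclidean_space n) L = discrete_topology L"
proof -
  have "openin (subtopology (Euclidean_space n) L) {x}" if x: "x \<in> L" for x
  proof -
    define U where "U = {y \<in> topspace (Euclidean_space n). \<forall>i<n. y i \<in> ball (x i) 1}"
    have "openin (Euclidean_space n) {y \<in> topspace (Euclidean_space n). y i \<in> ball (x i) 1}" for i
    proof (rule openin_continuous_map_preimage)
      show "continuous_map (Euclidean_space n) euclideanreal (\<lambda>y. y i)"
        unfolding Euclidean_space_def
        by (intro continuous_map_from_subtopology continuous_map_product_projection) simp
    qed simp
    \<comment> \<open>Intersecting with the whole space covers \<open>n = 0\<close>, where the
      indexed intersection is \<open>UNIV\<close>.\<close>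
    then have "openin (Euclidean_space n) (topspace (Euclidean_space n) \<inter>
        (\<Inter>i\<in>{..<n}. {y \<in> topspace (Euclidean_space n). y i \<in> ball (x i) 1}))"
      by (cases "n = 0") (auto intro!: openin_Int openin_INT)
    moreover have "U = topspace (Euclidean_space n) \<inter>
        (\<Inter>i\<in>{..<n}. {y \<in> topspace (Euclidean_space n). y i \<in> ball (x i) 1})"
      by (auto simp: U_def)
    ultimately have "openin (Euclidean_space n) U" by simp
    moreover have "{x} = U \<inter> L"
    proof (intro equalityI subsetI)
      fix y assume y: "y \<in> U \<inter> L"
      have "y i = x i" for i
      proof (cases "i < n")
        case True
        then have "\<bar>y i - x i\<bar> < 1" using y by (auto simp: U_def dist_real_def abs_minus_commute)
        then show ?thesis using Ints_eq_abs_less1[of "y i" "x i"] int x y by blast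
      next
        case False
        then have z: "z i = 0" if "z \<in> L" for z
          using subsetD[OF L that] by (simp add: topspace_Euclidean_space)
        show ?thesis using z[of x] z[of y] x y by simp
      qed
      then show "y \<in> {x}" by auto
    qed (use x L in \<open>auto simp: U_def\<close>)
    ultimately show ?thesis unfolding openin_subtopology by blast
  qed
  then show ?thesis
    using L discrete_topology_unique[of L "subtopology (Euclidean_space n) L"]
    by (auto simp: inf.absorb2)
qed

lemma is_lattice_integral_basis:
  assumes L: "lattice_basis n b L" and int: "\<And>i j. b i j \<in> \<int>"
  shows "is_lattice n L"
proof -
  have L_eq: "L = {(\<lambda>j. \<Sum>i<n. of_int (k i) * b i j) | k :: nat \<Rightarrow> int. True}"
    and b: "\<And>i. i < n \<Longrightarrow> b i \<in> topspace (Euclidean_space n)" and ind: "lin_indep n b"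
    using L by (auto simp: lattice_basis_def)
  have sub: "L \<subseteq> topspace (Euclidean_space n)"
    using b by (auto simp: L_eq topspace_Euclidean_space)
  have mem: "b i \<in> L" if "i < n" for i
  proof -
    have "b i = (\<lambda>j. \<Sum>k<n. of_int (if k = i then 1 else 0) * b k j)"
    proof
      fix j
      have "(\<Sum>k<n. of_int (if k = i then 1 else 0) * b k j) = (\<Sum>k<n. if k = i then b k j else 0)"
        by (intro sum.cong) auto
      then show "b i j = (\<Sum>k<n. of_int (if k = i then 1 else 0) * b k j)" using that by simp
    qed
    then show ?thesis
      unfolding L_eq by (intro CollectI exI[of _ "\<lambda>k. if k = i then 1 else 0"] conjI TrueI)
  qed
  have diff: "(\<lambda>j. x j - y j) \<in> L" if xy: "x \<in> L" "y \<in> L" for x y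
  proof -
    obtain k l :: "nat \<Rightarrow> int" where "x = (\<lambda>j. \<Sum>i<n. of_int (k i) * b i j)" "y = (\<lambda>j. \<Sum>i<n. of_int (l i) * b i j)"
      using xy unfolding L_eq by blast
    then have "(\<lambda>j. x j - y j) = (\<lambda>j. \<Sum>i<n. of_int (k i - l i) * b i j)"
      by (simp add: left_diff_distrib sum_subtractf)
    then show ?thesis
      unfolding L_eq by (intro CollectI exI[of _ "\<lambda>i. k i - l i"] conjI TrueI)
  qed
  have "(\<lambda>j. 0) \<in> L" unfolding L_eq by (rule CollectI, rule exI[of _ "\<lambda>_. 0"]) simp
  moreover have "x j \<in> \<int>" if "x \<in> L" for x j
    using that int by (auto simp: L_eq intro!: Ints_sum Ints_mult)
  ultimately show ?thesis
    unfolding is_lattice_def using sub diff mem ind discrete_Euclidean_space_Ints[OF sub] by blast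
qed

section \<open>The optimal parameter\<close>

text \<open>The ratio of consecutive powers, \<open>(1 + 1 / s) ^ m\<close>, decreases in
  \<open>s\<close> because \<open>s * (s + 2) \<le> (s + 1) * (s + 1)\<close>.\<close>

lemma power_ratio_mono:
  fixes s p m :: nat
  assumes "0 < s" "(s + 1) ^ m \<le> p * s ^ m"
  shows "(s + 2) ^ m \<le> p * (s + 1) ^ m"
proof -
  have "s ^ m * (s + 2) ^ m = (s * (s + 2)) ^ m" by (rule power_mult_distrib[symmetric])
  also have "\<dots> \<le> ((s + 1) * (s + 1)) ^ m" by (intro power_mono) auto
  also have "\<dots> = (s + 1) ^ m * (s + 1) ^ m" by (rule power_mult_distrib)
  also have "\<dots> \<le> (p * s ^ m) * (s + 1) ^ m" using assms(2) by (rule mult_right_mono) simp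
  also have "\<dots> = s ^ m * (p * (s + 1) ^ m)" by simp
  finally show ?thesis using assms(1) by simp
qed

text \<open>This guarantees that the search for the parameter stops at \<open>n\<close> at the
  latest.\<close>

lemma Suc_power_le:
  fixes n p :: nat
  assumes "1 \<le> n" "n < p"
  shows "(n + 1) ^ (n - 1) \<le> p * n ^ (n - 1)"
proof -
  have "(n + 1) ^ k \<le> (k + 1) * n ^ k" if "k \<le> n" for k
    using that
  proof (induction k)
    case (Suc k)
    have "(n + 1) ^ Suc k \<le> (n + 1) * ((k + 1) * n ^ k)"
      unfolding power_Suc using Suc by (intro mult_left_mono) auto
    also have "\<dots> = ((n + 1) * (k + 1)) * n ^ k" by (simp only: mult.assoc)
    \<comment> \<open>After multiplying out, this is just \<open>k + 1 \<le> n\<close>.\<close>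
    also have "\<dots> \<le> ((Suc k + 1) * n) * n ^ k" using Suc.prems by (intro mult_right_mono) auto
    finally show ?case by (simp only: power_Suc mult.assoc)
  qed simp
  from this[of "n - 1"] have "(n + 1) ^ (n - 1) \<le> n * n ^ (n - 1)" using assms by simp
  also have "\<dots> \<le> p * n ^ (n - 1)" using assms by (intro mult_right_mono) auto
  finally show ?thesis .
qed

text \<open>For \<open>s \<le> n\<close>, \<open>g s\<close> is \<open>fact n\<close> times the
  density of the lattice with parameter \<open>s\<close> at radius \<open>s\<close>. It rises before
  \<open>t\<close> since \<open>t\<close> is the first place where the criterion holds, and never
  rises after \<open>t\<close> by \<open>power_ratio_mono\<close>.\<close>

lemma gain_maximal:
  fixes n p t :: nat
  defines "g \<equiv> \<lambda>s::nat. (2 * real s) ^ (n - 1) / real p ^ (s - 1)"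
  assumes "0 < p" "1 \<le> t" "(t + 1) ^ (n - 1) \<le> p * t ^ (n - 1)"
    and least: "\<And>s. 1 \<le> s \<Longrightarrow> s < t \<Longrightarrow> p * s ^ (n - 1) < (s + 1) ^ (n - 1)"
    and "1 \<le> s"
  shows "g s \<le> g t"
proof -
  have step: "g (s + 1) \<le> g s \<longleftrightarrow> (s + 1) ^ (n - 1) \<le> p * s ^ (n - 1)" if "1 \<le> s" for s
  proof -
    have eq: "real p ^ s = real p * real p ^ (s - 1)" using that by (cases s) auto
    have "g (s + 1) \<le> g s \<longleftrightarrow> real (s + 1) ^ (n - 1) \<le> real p * real s ^ (n - 1)"
      using \<open>0 < p\<close> by (simp add: g_def eq power_mult_distrib field_simps)
    also have "\<dots> \<longleftrightarrow> real ((s + 1) ^ (n - 1)) \<le> real (p * s ^ (n - 1))" by simp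
    finally show ?thesis unfolding of_nat_le_iff .
  qed
  show ?thesis
  proof (cases "s \<le> t")
    case True
    then show ?thesis
    proof (induction rule: inc_induct)
      case (step k)
      have "1 \<le> k" using step \<open>1 \<le> s\<close> by simp
      then have "g k \<le> g (k + 1)" using step least[of k] \<open>\<And>s. 1 \<le> s \<Longrightarrow> _\<close>[of k] by linarith
      then show ?case using step by simp
    qed simp
  next
    case False
    then have "t \<le> s" by simp
    then have "g s \<le> g t \<and> (s + 1) ^ (n - 1) \<le> p * s ^ (n - 1)"
    proof (induction rule: dec_induct)
      case base
      then show ?case using assms by simp
    next
      case (step k)
      then show ?case
        using \<open>\<And>s. 1 \<le> s \<Longrightarrow> _\<close>[of k] power_ratio_mono[of k "n - 1" p] \<open>1 \<le> t\<close> by force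
    qed
    then show ?thesis ..
  qed
qed

text \<open>The power is at most \<open>exp 1 ^ 2\<close>. Having the constant below 11 allows a
  step from \<open>t\<close> to \<open>t - 1\<close> for all primes from 11 on.\<close>

lemma Suc_power_le_9:
  fixes s n :: nat
  assumes "1 \<le> s" "n \<le> 2 * s"
  shows "real (s + 1) ^ n \<le> 9 * real s ^ n"
proof -
  have "(1 + 1 / real s) ^ n \<le> (1 + 1 / real s) ^ (2 * s)"
    using assms by (intro power_increasing) auto
  also have "\<dots> \<le> exp (1 / real s) ^ (2 * s)"
    by (intro power_mono exp_ge_add_one_self) auto
  also have "\<dots> = exp 1 ^ 2"
    using assms by (simp add: exp_of_nat_mult[symmetric])
  also have "\<dots> \<le> 3 ^ 2" by (intro power_mono exp_le) auto
  finally have "(1 + 1 / real s) ^ n * real s ^ n \<le> 9 * real s ^ n"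
    by (intro mult_right_mono) auto
  moreover have "(1 + 1 / real s) ^ n * real s ^ n = real (s + 1) ^ n"
    using assms by (simp add: power_mult_distrib[symmetric] field_simps)
  ultimately show ?thesis by simp
qed

text \<open>\<open>s = t\<close> works when \<open>2 t \<le> p\<close>. Beyond that, the left-hand side decreases in \<open>t\<close>, except for a few
  small \<open>p\<close>, where \<open>s = (p - 1) / 2\<close> works.\<close>

lemma density_le_gain:
  fixes n p t :: nat
  assumes p: "prime p" and "n < p" and t: "1 \<le> t" "t \<le> n"
  shows "\<exists>s\<ge>1. (2 * real t) ^ n / real p ^ t \<le> (2 * real s) ^ (n - 1) / real p ^ (s - 1)"
  using t
proof (induction t rule: less_induct)
  case (less t)
  have p0: "real p > 0" using \<open>n < p\<close> by simp
  consider "2 * t \<le> p" | "p < 2 * t" "11 \<le> p" | "p < 2 * t" "p < 11" by linarith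
  then show ?case
  proof cases
    case 1
    have n: "(2 * real t) ^ n = 2 * real t * (2 * real t) ^ (n - 1)" using less.prems by (cases n) auto
    have pt: "real p ^ t = real p * real p ^ (t - 1)" using less.prems by (cases t) auto
    have "(2 * real t) ^ n / real p ^ t = (2 * real t / real p) * ((2 * real t) ^ (n - 1) / real p ^ (t - 1))"
      unfolding n pt by simp
    also have "\<dots> \<le> 1 * ((2 * real t) ^ (n - 1) / real p ^ (t - 1))"
      using 1 p0 by (intro mult_right_mono) auto
    finally show ?thesis using less.prems by auto
  next
    case 2
    define s where "s = t - 1"
    have ts: "t = s + 1" using less.prems by (simp add: s_def)
    \<comment> \<open>Oddness sharpens \<open>p < 2 * t\<close> to \<open>p + 1 \<le> 2 * t\<close>,
      so that \<open>n \<le> p - 1 \<le> 2 * s\<close>.\<close>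
    have "odd p" using prime_odd_nat[OF p] 2 by simp
    then have "p + 1 \<le> 2 * t" using 2 by presburger
    then have s: "1 \<le> s" "n \<le> 2 * s" using 2 \<open>n < p\<close> by (auto simp: ts)
    have "real t ^ n \<le> real p * real s ^ n"
    proof -
      have "real t ^ n \<le> 9 * real s ^ n" unfolding ts by (rule Suc_power_le_9[OF s])
      also have "\<dots> \<le> real p * real s ^ n" using 2 by (intro mult_right_mono) auto
      finally show ?thesis .
    qed
    then have "(2 * real t) ^ n / real p ^ t \<le> (2 * real s) ^ n / real p ^ s"
    proof -
      have "(2 * real t) ^ n \<le> real p * (2 * real s) ^ n"
        using mult_left_mono[OF \<open>real t ^ n \<le> _\<close>, of "2 ^ n"] by (simp only: power_mult_distrib) simp
      then show ?thesis using p0 by (simp add: ts field_simps)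
    qed
    then show ?thesis using less.IH[of s] s less.prems ts by fastforce
  next
    case 3
    have "p \<noteq> 4" "p \<noteq> 6" "p \<noteq> 8" "p \<noteq> 9" "p \<noteq> 10" using p by auto
    then consider "p = 2" | "p = 3" | "p = 5" | "p = 7"
      using 3 prime_ge_2_nat[OF p] by linarith
    then show ?thesis
    proof cases
      case 1
      then show ?thesis using 3 less.prems \<open>n < p\<close> by simp
    next
      case 2
      then have "n = 2" "t = 2" using 3 less.prems \<open>n < p\<close> by auto
      then show ?thesis using 2 by (intro exI[of _ 1]) simp
    next
      case p: 3
      then consider "n = 3" "t = 3" | "n = 4" "t = 3" | "n = 4" "t = 4"
        using 3 less.prems \<open>n < p\<close> by linarith
      then show ?thesis by cases (use p in \<open>auto intro!: exI[of _ 2]\<close>)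
    next
      case p: 4
      then have "n = 4 \<or> n = 5 \<or> n = 6" "t = 4 \<or> t = 5 \<or> t = 6"
        using 3 less.prems \<open>n < p\<close> by linarith+
      then show ?thesis using p less.prems by (elim disjE) (auto intro!: exI[of _ 3])
    qed
  qed
qed

text \<open>A packing remains one when its radius shrinks, so every positive density up to the one
  at radius \<open>R\<close> can be attained; the radius solves
  \<open>(2 * r) ^ n = D * c\<close>.\<close>

lemma exists_radius:
  fixes D R c :: real
  assumes "1 \<le> n" "0 < D" "0 < c" "0 < R" "D \<le> (2 * R) ^ n / c"
  shows "\<exists>r>0. r \<le> R \<and> (2 * r) ^ n / c = D"
proof (intro exI[of _ "root n (D * c) / 2"] conjI)
  show "0 < root n (D * c) / 2" using assms by simp
  have "root n (D * c) \<le> root n ((2 * R) ^ n)"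
    using assms by (intro real_root_le_mono) (auto simp: field_simps)
  also have "\<dots> = 2 * R" using assms by (intro real_root_power_cancel) auto
  finally show "root n (D * c) / 2 \<le> R" by simp
  show "(2 * (root n (D * c) / 2)) ^ n / c = D" using assms by simp
qed

section \<open>A timed Hoare logic\<close>

definition hoare :: "(mem \<Rightarrow> bool) \<Rightarrow> com \<Rightarrow> nat \<Rightarrow> (mem \<Rightarrow> bool) \<Rightarrow> bool" where
  "hoare P c T Q \<longleftrightarrow> (\<forall>m. P m \<longrightarrow> (\<exists>T' m'. runs c m T' m' \<and> T' \<le> T \<and> Q m'))"

text \<open>Loop-free code is verified by computing this precondition; loops go through
  \<open>hoare_While\<close> with an explicit variant.\<close>

fun wp :: "com \<Rightarrow> (mem \<Rightarrow> bool) \<Rightarrow> mem \<Rightarrow> bool" where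
  "wp Skip Q m = Q m"
| "wp (Assign a i e) Q m = Q (m(a := (m a)(aval i m := aval e m)))"
| "wp (Seq c1 c2) Q m = wp c1 (wp c2 Q) m"
| "wp (If b c1 c2) Q m = (if bval b m then wp c1 Q m else wp c2 Q m)"
| "wp (While b c) Q m = False"

text \<open>Since \<open>wp\<close> is \<open>False\<close> on loops, their cost is irrelevant.\<close>

fun cost :: "com \<Rightarrow> nat" where
  "cost Skip = 1"
| "cost (Assign a i e) = 1 + acost i + acost e"
| "cost (Seq c1 c2) = cost c1 + cost c2"
| "cost (If b c1 c2) = 1 + bcost b + cost c1 + cost c2"
| "cost (While b c) = 0"

lemma hoare_wp: "hoare (wp c Q) c (cost c) Q"
proof (induction c arbitrary: Q)
  case (Seq c1 c2)
  show ?case unfolding hoare_def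
  proof (intro allI impI)
    fix m assume "wp (Seq c1 c2) Q m"
    then obtain T1 m1 where 1: "runs c1 m T1 m1" "T1 \<le> cost c1" "wp c2 Q m1"
      using Seq(1)[of "wp c2 Q"] unfolding hoare_def by auto
    then obtain T2 m2 where 2: "runs c2 m1 T2 m2" "T2 \<le> cost c2" "Q m2"
      using Seq(2)[of Q] unfolding hoare_def by auto
    show "\<exists>T m'. runs (Seq c1 c2) m T m' \<and> T \<le> cost (Seq c1 c2) \<and> Q m'"
      using runs.Seq[OF 1(1) 2(1)] 1 2 by force
  qed
next
  case (If b c1 c2)
  show ?case unfolding hoare_def
  proof (intro allI impI)
    fix m assume wp: "wp (If b c1 c2) Q m"
    show "\<exists>T m'. runs (If b c1 c2) m T m' \<and> T \<le> cost (If b c1 c2) \<and> Q m'"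
    proof (cases "bval b m")
      case True
      then obtain T m' where "runs c1 m T m'" "T \<le> cost c1" "Q m'"
        using If(1)[of Q] wp unfolding hoare_def by auto
      then show ?thesis using runs.IfTrue[OF True] by fastforce
    next
      case False
      then obtain T m' where "runs c2 m T m'" "T \<le> cost c2" "Q m'"
        using If(2)[of Q] wp unfolding hoare_def by auto
      then show ?thesis using runs.IfFalse[OF False] by fastforce
    qed
  qed
next
  case Skip
  show ?case unfolding hoare_def using runs.Skip by fastforce
next
  case (Assign a i e)
  show ?case unfolding hoare_def using runs.Assign by fastforce
qed (simp add: hoare_def)

lemma hoare_straight: "(\<And>m. P m \<Longrightarrow> wp c Q m) \<Longrightarrow> cost c \<le> T \<Longrightarrow> hoare P c T Q"
  using hoare_wp[of c Q] unfolding hoare_def by (meson order_trans)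

lemma hoare_weaken:
  "hoare P c T Q \<Longrightarrow> (\<And>m. P' m \<Longrightarrow> P m) \<Longrightarrow> T \<le> T' \<Longrightarrow> (\<And>m. Q m \<Longrightarrow> Q' m) \<Longrightarrow> hoare P' c T' Q'"
  unfolding hoare_def by (meson order_trans)

lemma hoare_Seq: "hoare P c1 T1 R \<Longrightarrow> hoare R c2 T2 Q \<Longrightarrow> hoare P (Seq c1 c2) (T1 + T2) Q"
  unfolding hoare_def by (meson add_mono_thms_linordered_semiring(1) runs.Seq)

lemma hoare_all: "(\<And>x. hoare (P x) c T Q) \<Longrightarrow> hoare (\<lambda>m. \<exists>x. P x m) c T Q"
  unfolding hoare_def by blast

text \<open>The variant drops in each round, so there are at most \<open>K\<close> rounds and one
  final failing test.\<close>

lemma hoare_While: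
  fixes v :: "mem \<Rightarrow> nat"
  assumes body: "\<And>k. hoare (\<lambda>m. I m \<and> bval b m \<and> v m = k) c T (\<lambda>m. I m \<and> v m < k)"
  shows "hoare (\<lambda>m. I m \<and> v m \<le> K) (While b c) ((K + 1) * (1 + bcost b + T)) (\<lambda>m. I m \<and> \<not> bval b m)"
proof -
  have "\<exists>T' m'. runs (While b c) m T' m' \<and> T' \<le> (v m + 1) * (1 + bcost b + T) \<and> I m' \<and> \<not> bval b m'"
    if "I m" for m
    using that
  proof (induction "v m" arbitrary: m rule: less_induct)
    case less
    show ?case
    proof (cases "bval b m")
      case False
      then show ?thesis using less.prems runs.WhileFalse[of b m c] by fastforce
    next
      case True
      then obtain T1 m1 where 1: "runs c m T1 m1" "T1 \<le> T" "I m1" "v m1 < v m"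
        using body[of "v m"] less.prems unfolding hoare_def by blast
      then obtain T2 m2 where 2: "runs (While b c) m1 T2 m2" "T2 \<le> (v m1 + 1) * (1 + bcost b + T)"
        "I m2" "\<not> bval b m2" using less.hyps by blast
      have "(v m1 + 1) * (1 + bcost b + T) \<le> v m * (1 + bcost b + T)"
        using 1(4) by (intro mult_right_mono) auto
      then have "1 + bcost b + T1 + T2 \<le> (v m + 1) * (1 + bcost b + T)"
        using 1(2) 2(2) by simp
      then show ?thesis using runs.WhileTrue[OF True 1(1) 2(1)] 2 by blast
    qed
  qed
  moreover have "(v m + 1) * (1 + bcost b + T) \<le> (K + 1) * (1 + bcost b + T)" if "v m \<le> K" for m
    using that by (intro mult_right_mono) auto
  ultimately show ?thesis unfolding hoare_def by (meson order_trans)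
qed

text \<open>Entry \<open>k\<close> of array \<open>0\<close> serves as register \<open>k\<close>. The registers hold: \<open>0\<close> the dimension \<open>n\<close>,
  \<open>1\<close> the prime \<open>p\<close>, \<open>4\<close> the parameter \<open>t\<close>; the others are scratch.\<close>

abbreviation reg :: "int \<Rightarrow> aexp" where "reg k \<equiv> Get 0 (Num k)"
abbreviation set_reg :: "int \<Rightarrow> aexp \<Rightarrow> com" where "set_reg k e \<equiv> Assign 0 (Num k) e"

text \<open>A frame condition: a subroutine may change only the registers in \<open>S\<close> and
  leaves the output array alone.\<close>

definition agree :: "int set \<Rightarrow> mem \<Rightarrow> mem \<Rightarrow> bool" where
  "agree S m0 m \<longleftrightarrow> m 1 = m0 1 \<and> (\<forall>k. k \<notin> S \<longrightarrow> m 0 k = m0 0 k)"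

text \<open>Repeated addition, as the machine cannot multiply. The time is linear in the value of
  \<open>y\<close>, so a factor that may be exponentially large has to be passed as
  \<open>x\<close>.\<close>

definition mul_code :: "int \<Rightarrow> aexp \<Rightarrow> aexp \<Rightarrow> com" where
  "mul_code z x y = Seq (Seq (set_reg z (Num 0)) (set_reg 20 (Num 0)))
     (While (Less (reg 20) y) (Seq (set_reg z (Plus (reg z) x)) (set_reg 20 (Plus (reg 20) (Num 1)))))"

text \<open>The loop evaluates \<open>x\<close> and \<open>y\<close> anew in each round, hence the
  assumption that they are stable under changes of \<open>z\<close> and the counter.\<close>

lemma hoare_mul:
  assumes xy: "\<And>m. agree {z, 20} m0 m \<Longrightarrow> aval x m = X \<and> aval y m = int Y" and z: "z \<noteq> 20"
    and c: "acost x \<le> 5" "acost y \<le> 5"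
  shows "hoare (\<lambda>m. m = m0) (mul_code z x y) (50 * (Y + 1))
     (\<lambda>m. agree {z, 20} m0 m \<and> m 0 z = X * int Y)"
proof -
  define I where "I m \<longleftrightarrow> (\<exists>i\<le>Y. agree {z, 20} m0 m \<and> m 0 20 = int i \<and> m 0 z = X * int i)" for m
  have 1: "hoare (\<lambda>m. m = m0) (Seq (set_reg z (Num 0)) (set_reg 20 (Num 0))) 6
      (\<lambda>m. I m \<and> nat (int Y - m 0 20) \<le> Y)"
    by (rule hoare_straight) (auto simp: I_def agree_def z)
  have 2: "hoare (\<lambda>m. I m \<and> bval (Less (reg 20) y) m \<and> nat (int Y - m 0 20) = k)
      (Seq (set_reg z (Plus (reg z) x)) (set_reg 20 (Plus (reg 20) (Num 1)))) 20
      (\<lambda>m. I m \<and> nat (int Y - m 0 20) < k)" for k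
  proof (rule hoare_straight)
    fix m assume m: "I m \<and> bval (Less (reg 20) y) m \<and> nat (int Y - m 0 20) = k"
    then obtain i where i: "i \<le> Y" "agree {z, 20} m0 m" "m 0 20 = int i" "m 0 z = X * int i"
      by (auto simp: I_def)
    have xy': "aval x m = X" "aval y m = int Y" using xy[OF i(2)] by auto
    have "i < Y" using m xy' i by simp
    then show "wp (Seq (set_reg z (Plus (reg z) x)) (set_reg 20 (Plus (reg 20) (Num 1))))
        (\<lambda>m. I m \<and> nat (int Y - m 0 20) < k) m"
      using m i z xy' by (auto simp: I_def agree_def algebra_simps intro!: exI[of _ "Suc i"])
  qed (use c in auto)
  have "hoare (\<lambda>m. m = m0) (mul_code z x y) (6 + (Y + 1) * (1 + bcost (Less (reg 20) y) + 20))
      (\<lambda>m. I m \<and> \<not> bval (Less (reg 20) y) m)"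
    unfolding mul_code_def by (rule hoare_Seq[OF 1 hoare_While[OF 2]])
  then show ?thesis
  proof (rule hoare_weaken)
    show "6 + (Y + 1) * (1 + bcost (Less (reg 20) y) + 20) \<le> 50 * (Y + 1)"
    proof -
      have "(Y + 1) * (1 + bcost (Less (reg 20) y) + 20) \<le> (Y + 1) * 30"
        by (rule mult_left_mono) (use c in auto)
      then have "6 + (Y + 1) * (1 + bcost (Less (reg 20) y) + 20) \<le> 6 + (Y + 1) * 30"
        by (rule add_left_mono)
      also have "\<dots> \<le> 50 * (Y + 1)" by simp
      finally show ?thesis .
    qed
  next
    fix m assume m: "I m \<and> \<not> bval (Less (reg 20) y) m"
    then obtain i where i: "i \<le> Y" "agree {z, 20} m0 m" "m 0 20 = int i" "m 0 z = X * int i"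
      by (auto simp: I_def)
    have "aval y m = int Y" using xy[OF i(2)] by auto
    then have "i = Y" using m i by simp
    then show "agree {z, 20} m0 m \<and> m 0 z = X * int Y" using i by simp
  qed simp
qed

text \<open>The counter starts at 1, so the exponent is \<open>n - 1\<close>. The growing power is
  the first factor of the product, and the product needs its own register because
  \<open>mul_code\<close> clears its target.\<close>

definition pow_code :: "int \<Rightarrow> aexp \<Rightarrow> com" where
  "pow_code z x = Seq (Seq (set_reg z (Num 1)) (set_reg 21 (Num 1)))
     (While (Less (reg 21) (reg 0)) (Seq (mul_code 22 (reg z) x)
       (Seq (set_reg z (reg 22)) (set_reg 21 (Plus (reg 21) (Num 1))))))"

lemma agree_trans: "agree S m0 m1 \<Longrightarrow> agree S' m1 m2 \<Longrightarrow> S \<union> S' \<subseteq> S'' \<Longrightarrow> agree S'' m0 m2"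
  unfolding agree_def by (metis Un_iff subsetD)

lemma hoare_fix: "(\<And>m0. P m0 \<Longrightarrow> hoare (\<lambda>m. m = m0) c T Q) \<Longrightarrow> hoare P c T Q"
  unfolding hoare_def by blast

lemma hoare_pow:
  assumes x: "\<And>m. agree {z, 20, 21, 22} m0 m \<Longrightarrow> aval x m = int X" "acost x \<le> 5"
    and n: "m0 0 0 = int n" "1 \<le> n" and z: "z \<notin> {0, 20, 21, 22}"
  shows "hoare (\<lambda>m. m = m0) (pow_code z x) (n * (50 * (X + 2)))
     (\<lambda>m. agree {z, 20, 21, 22} m0 m \<and> m 0 z = int (X ^ (n - 1)))"
proof -
  let ?S = "{z, 20, 21, 22}"
  define I where "I m \<longleftrightarrow> (\<exists>k\<ge>1. k \<le> n \<and> agree ?S m0 m \<and> m 0 21 = int k \<and> m 0 z = int (X ^ (k - 1)))" for m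
  have I0: "m 0 0 = int n" if "I m" for m using that z n by (auto simp: I_def agree_def)
  have 1: "hoare (\<lambda>m. m = m0) (Seq (set_reg z (Num 1)) (set_reg 21 (Num 1))) 6
      (\<lambda>m. I m \<and> nat (int n - m 0 21) \<le> n - 1)"
    by (rule hoare_straight) (use z n in \<open>auto simp: I_def agree_def intro!: exI[of _ 1]\<close>)
  have 2: "hoare (\<lambda>m. I m \<and> bval (Less (reg 21) (reg 0)) m \<and> nat (int n - m 0 21) = k)
      (Seq (mul_code 22 (reg z) x) (Seq (set_reg z (reg 22)) (set_reg 21 (Plus (reg 21) (Num 1)))))
      (50 * (X + 1) + 10) (\<lambda>m. I m \<and> nat (int n - m 0 21) < k)" for k
  proof (rule hoare_fix)
    fix m1 assume m1: "I m1 \<and> bval (Less (reg 21) (reg 0)) m1 \<and> nat (int n - m1 0 21) = k"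
    then obtain i where i: "i \<ge> 1" "agree ?S m0 m1" "m1 0 21 = int i" "m1 0 z = int (X ^ (i - 1))"
      by (auto simp: I_def)
    have "i < n" using m1 i I0[of m1] by simp
    have a: "hoare (\<lambda>m. m = m1) (mul_code 22 (reg z) x) (50 * (X + 1))
        (\<lambda>m. agree {22, 20} m1 m \<and> m 0 22 = int (X ^ (i - 1)) * int X)"
    proof (rule hoare_mul)
      fix m assume m: "agree {22, 20} m1 m"
      have "agree ?S m0 m" by (rule agree_trans[OF i(2) m]) auto
      then show "aval (reg z) m = int (X ^ (i - 1)) \<and> aval x m = int X"
        using m i z x by (auto simp: agree_def)
    qed (use x in auto)
    have e: "int (X ^ (i - 1)) * int X = int (X ^ i)" using i(1) by (cases i) auto
    have b: "hoare (\<lambda>m. agree {22, 20} m1 m \<and> m 0 22 = int (X ^ (i - 1)) * int X)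
       (Seq (set_reg z (reg 22)) (set_reg 21 (Plus (reg 21) (Num 1)))) 10
       (\<lambda>m. I m \<and> nat (int n - m 0 21) < k)"
    proof (rule hoare_straight)
      fix m assume m: "agree {22, 20} m1 m \<and> m 0 22 = int (X ^ (i - 1)) * int X"
      then have ag: "agree ?S m0 m" by (intro agree_trans[OF i(2), of "{22, 20}"]) auto
      have val: "m 0 21 = int i" "m 0 22 = int (X ^ i)"
        using m i z unfolding e by (auto simp: agree_def)
      show "wp (Seq (set_reg z (reg 22)) (set_reg 21 (Plus (reg 21) (Num 1)))) (\<lambda>m. I m \<and> nat (int n - m 0 21) < k) m"
        using ag val z i \<open>i < n\<close> m1 by (auto simp: I_def agree_def intro!: exI[of _ "Suc i"])
    qed auto
    show "hoare (\<lambda>m. m = m1) (Seq (mul_code 22 (reg z) x) (Seq (set_reg z (reg 22)) (set_reg 21 (Plus (reg 21) (Num 1)))))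
      (50 * (X + 1) + 10) (\<lambda>m. I m \<and> nat (int n - m 0 21) < k)"
      by (rule hoare_Seq[OF a b])
  qed
  have "hoare (\<lambda>m. m = m0) (pow_code z x) (6 + (n - 1 + 1) * (1 + bcost (Less (reg 21) (reg 0)) + (50 * (X + 1) + 10)))
      (\<lambda>m. I m \<and> \<not> bval (Less (reg 21) (reg 0)) m)"
    unfolding pow_code_def by (rule hoare_Seq[OF 1 hoare_While[OF 2]])
  then show ?thesis
  proof (rule hoare_weaken)
    show "6 + (n - 1 + 1) * (1 + bcost (Less (reg 21) (reg 0)) + (50 * (X + 1) + 10)) \<le> n * (50 * (X + 2))"
      using n(2) by (simp add: algebra_simps)
  next
    fix m assume m: "I m \<and> \<not> bval (Less (reg 21) (reg 0)) m"
    then show "agree ?S m0 m \<and> m 0 z = int (X ^ (n - 1))"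
      using I0[of m] by (auto simp: I_def)
  qed simp
qed

section \<open>The algorithm\<close>

definition base_inv :: "nat \<Rightarrow> mem \<Rightarrow> bool" where
  "base_inv n m \<longleftrightarrow> m 0 0 = int n \<and> m 1 = (\<lambda>_. 0)"

definition rem_body :: com where "rem_body = set_reg 3 (Minus (reg 3) (reg 2))"

definition rem_code :: com where
  "rem_code = Seq (set_reg 3 (reg 1)) (While (Less (Num 0) (reg 3)) rem_body)"

text \<open>Subtracting \<open>d\<close> until the value is no longer positive leaves a number above
  \<open>- d\<close> and at most 0, congruent to \<open>p\<close>; it is 0 exactly when
  \<open>d\<close> divides \<open>p\<close>.\<close>

lemma hoare_rem:
  assumes m0: "m0 0 1 = int p" "m0 0 2 = int d" and d: "2 \<le> d"
  shows "hoare (\<lambda>m. m = m0) rem_code (20 * (p + 1))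
    (\<lambda>m. agree {3} m0 m \<and> m 0 3 \<le> 0 \<and> (m 0 3 < 0 \<longleftrightarrow> \<not> d dvd p))"
proof -
  define I where "I m \<longleftrightarrow> agree {3} m0 m \<and> - int d < m 0 3 \<and> int d dvd int p - m 0 3" for m
  have 1: "hoare (\<lambda>m. m = m0) (set_reg 3 (reg 1)) 4 (\<lambda>m. I m \<and> nat (m 0 3) \<le> p)"
    by (rule hoare_straight) (use m0 d in \<open>auto simp: I_def agree_def\<close>)
  have 2: "hoare (\<lambda>m. I m \<and> bval (Less (Num 0) (reg 3)) m \<and> nat (m 0 3) = k) rem_body 8
      (\<lambda>m. I m \<and> nat (m 0 3) < k)" for k
    unfolding rem_body_def
  proof (rule hoare_straight)
    fix m assume m: "I m \<and> bval (Less (Num 0) (reg 3)) m \<and> nat (m 0 3) = k"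
    have m2: "m 0 2 = int d" using m m0 by (auto simp: I_def agree_def)
    have "int d dvd int p - m 0 3 + int d" using m by (simp add: I_def)
    then have "int d dvd int p - (m 0 3 - int d)" by (simp add: algebra_simps)
    then show "wp (set_reg 3 (Minus (reg 3) (reg 2))) (\<lambda>m. I m \<and> nat (m 0 3) < k) m"
      using m m2 d by (auto simp: I_def agree_def)
  qed auto
  have "hoare (\<lambda>m. m = m0) rem_code (4 + (p + 1) * (1 + bcost (Less (Num 0) (reg 3)) + 8))
      (\<lambda>m. I m \<and> \<not> bval (Less (Num 0) (reg 3)) m)"
    unfolding rem_code_def by (rule hoare_Seq[OF 1 hoare_While[OF 2]])
  then show ?thesis
  proof (rule hoare_weaken)
    fix m assume m: "I m \<and> \<not> bval (Less (Num 0) (reg 3)) m"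
    then have le: "m 0 3 \<le> 0" "- int d < m 0 3" "int d dvd int p - m 0 3" by (auto simp: I_def)
    have "m 0 3 = 0 \<longleftrightarrow> int d dvd int p"
    proof
      assume "int d dvd int p"
      then have "int d dvd - m 0 3" using le(3) dvd_diff_right_iff[of "int d" "int p" "m 0 3"] by simp
      then show "m 0 3 = 0" using le zdvd_imp_le[of "int d" "- m 0 3"] by linarith
    qed (use le(3) in simp)
    then show "agree {3} m0 m \<and> m 0 3 \<le> 0 \<and> (m 0 3 < 0 \<longleftrightarrow> \<not> d dvd p)"
      using m le by (auto simp: I_def)
  qed auto
qed

text \<open>A single loop runs over pairs of a candidate and a trial divisor: a non-divisor advances
  the divisor, a divisor advances the candidate and resets the divisor to 2.\<close>

definition prime_step :: com where
  "prime_step = If (Less (reg 3) (Num 0)) (set_reg 2 (Plus (reg 2) (Num 1)))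
     (Seq (set_reg 1 (Plus (reg 1) (Num 1))) (set_reg 2 (Num 2)))"

definition prime_code :: com where
  "prime_code = Seq (Seq (set_reg 1 (Plus (reg 0) (Num 1))) (set_reg 2 (Num 2)))
     (While (Less (reg 2) (reg 1)) (Seq rem_code prime_step))"

definition prime_inv :: "nat \<Rightarrow> nat \<Rightarrow> nat \<Rightarrow> mem \<Rightarrow> bool" where
  "prime_inv n p d m \<longleftrightarrow> base_inv n m \<and> m 0 1 = int p \<and> m 0 2 = int d \<and> n < p \<and>
     p \<le> next_prime n \<and> 2 \<le> d \<and> d \<le> p \<and> (\<forall>e. 2 \<le> e \<longrightarrow> e < d \<longrightarrow> \<not> e dvd p)"

lemma hoare_prime:
  assumes n: "1 \<le> n"
  defines "P \<equiv> next_prime n"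
  shows "hoare (\<lambda>m. m = input_mem n) prime_code (50 * ((P * P + P + 1) * (P + 1)))
    (\<lambda>m. base_inv n m \<and> m 0 1 = int P)"
proof -
  \<comment> \<open>The lexicographic order on candidate and divisor, flattened with weight
    \<open>P\<close>: resetting the divisor costs less than the \<open>P\<close> gained by advancing
    the candidate.\<close>
  define v :: "mem \<Rightarrow> nat" where "v m = (P - nat (m 0 1)) * P + (P - nat (m 0 2))" for m
  define I where "I m \<longleftrightarrow> (\<exists>p d. prime_inv n p d m)" for m
  have nP: "n < P" "prime P" unfolding P_def by (rule next_prime_gt prime_next_prime)+
  have 1: "hoare (\<lambda>m. m = input_mem n) (Seq (set_reg 1 (Plus (reg 0) (Num 1))) (set_reg 2 (Num 2))) 20
      (\<lambda>m. I m \<and> v m \<le> P * P + P)"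
  proof (rule hoare_straight)
    fix m assume m: "m = input_mem n"
    have "(P - Suc n) * P + (P - 2) \<le> P * P + P" by (intro add_mono mult_right_mono) auto
    define m' where "m' = m(0 := (m 0)(1 := m 0 0 + 1, 2 := 2))"
    have "prime_inv n (n + 1) 2 m'"
      using n nP by (auto simp: m'_def m input_mem_def prime_inv_def base_inv_def P_def[symmetric])
    then have "I m'" unfolding I_def by blast
    moreover have "v m' = (P - Suc n) * P + (P - 2)"
      by (simp add: v_def m'_def m input_mem_def nat_add_distrib)
    ultimately show "wp (Seq (set_reg 1 (Plus (reg 0) (Num 1))) (set_reg 2 (Num 2))) (\<lambda>m. I m \<and> v m \<le> P * P + P) m"
      using \<open>_ \<le> P * P + P\<close> by (simp add: m'_def)
  qed auto
  have 2: "hoare (\<lambda>m. I m \<and> bval (Less (reg 2) (reg 1)) m \<and> v m = k) (Seq rem_code prime_step)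
      (20 * (P + 1) + 20) (\<lambda>m. I m \<and> v m < k)" for k
  proof (rule hoare_fix)
    fix m1 assume m1: "I m1 \<and> bval (Less (reg 2) (reg 1)) m1 \<and> v m1 = k"
    then obtain p d where inv: "prime_inv n p d m1" by (auto simp: I_def)
    have pd: "m1 0 1 = int p" "m1 0 2 = int d" "2 \<le> d" "d < p" "n < p" "p \<le> P" "base_inv n m1"
      "\<And>e. 2 \<le> e \<Longrightarrow> e < d \<Longrightarrow> \<not> e dvd p"
      using inv m1 by (auto simp: prime_inv_def P_def)
    have "hoare (\<lambda>m. m = m1) rem_code (20 * (P + 1))
        (\<lambda>m. agree {3} m1 m \<and> m 0 3 \<le> 0 \<and> (m 0 3 < 0 \<longleftrightarrow> \<not> d dvd p))"
      by (rule hoare_weaken[OF hoare_rem[of m1 p d]]) (use pd in auto)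
    moreover have "hoare (\<lambda>m. agree {3} m1 m \<and> m 0 3 \<le> 0 \<and> (m 0 3 < 0 \<longleftrightarrow> \<not> d dvd p))
        prime_step 20 (\<lambda>m. I m \<and> v m < k)"
    proof (rule hoare_straight)
      fix m assume m: "agree {3} m1 m \<and> m 0 3 \<le> 0 \<and> (m 0 3 < 0 \<longleftrightarrow> \<not> d dvd p)"
      then have regs: "m 0 0 = int n" "m 1 = (\<lambda>_. 0)" "m 0 1 = int p" "m 0 2 = int d"
        using pd by (auto simp: agree_def base_inv_def)
      have k: "k = (P - p) * P + (P - d)" using m1 pd by (auto simp: v_def)
      show "wp prime_step (\<lambda>m. I m \<and> v m < k) m"
      proof (cases "d dvd p")
        case False
        have "\<not> e dvd p" if "2 \<le> e" "e < d + 1" for e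
          using that pd(8)[of e] False by (cases "e = d") auto
        moreover have "P - (d + 1) < P - d" using pd by simp
        ultimately show ?thesis
          using m regs pd False
          by (auto simp: prime_step_def I_def prime_inv_def base_inv_def v_def k P_def[symmetric] nat_add_distrib
              intro!: exI[of _ p] exI[of _ "d + 1"])
      next
        case True
        \<comment> \<open>The divisor found is proper, so the candidate is composite and the search
          cannot run past \<open>P\<close>.\<close>
        then have "p \<noteq> P" using nP pd prime_nat_iff[of P] by auto
        then have "p < P" using pd by simp
        moreover have "(P - (p + 1)) * P + (P - 2) < (P - p) * P + (P - d)"
        proof -
          have "P - p = Suc (P - (p + 1))" using \<open>p < P\<close> by simp
          then have "(P - p) * P = (P - (p + 1)) * P + P" by simp
          then show ?thesis using pd \<open>p < P\<close> by linarith
        qed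
        moreover define m' where "m' = m(0 := (m 0)(1 := m 0 1 + 1, 2 := 2))"
        have "prime_inv n (p + 1) 2 m'"
          using regs pd \<open>p < P\<close> by (auto simp: m'_def prime_inv_def base_inv_def P_def[symmetric])
        then have "I m'" unfolding I_def by blast
        moreover have "v m' = (P - (p + 1)) * P + (P - 2)"
          using regs by (simp add: v_def m'_def nat_add_distrib)
        ultimately show ?thesis
          using m True k by (simp add: prime_step_def m'_def)
      qed
    qed (simp add: prime_step_def)
    ultimately show "hoare (\<lambda>m. m = m1) (Seq rem_code prime_step) (20 * (P + 1) + 20) (\<lambda>m. I m \<and> v m < k)"
      by (rule hoare_Seq)
  qed
  have "hoare (\<lambda>m. m = input_mem n) prime_code
      (20 + (P * P + P + 1) * (1 + bcost (Less (reg 2) (reg 1)) + (20 * (P + 1) + 20)))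
      (\<lambda>m. I m \<and> \<not> bval (Less (reg 2) (reg 1)) m)"
    unfolding prime_code_def by (rule hoare_Seq[OF 1 hoare_While[OF 2]])
  then show ?thesis
  proof (rule hoare_weaken)
    have "20 + (P * P + P + 1) * (1 + bcost (Less (reg 2) (reg 1)) + (20 * (P + 1) + 20)) \<le>
        (P * P + P + 1) * 20 + (P * P + P + 1) * (6 + (20 * (P + 1) + 20))"
      by (intro add_mono mult_left_mono) auto
    also have "\<dots> = (P * P + P + 1) * (46 + 20 * (P + 1))" by (simp only: distrib_left[symmetric]) simp
    also have "\<dots> \<le> (P * P + P + 1) * (50 * (P + 1))" by (rule mult_left_mono) (use nP n in auto)
    finally show "20 + (P * P + P + 1) * (1 + bcost (Less (reg 2) (reg 1)) + (20 * (P + 1) + 20)) \<le>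
        50 * ((P * P + P + 1) * (P + 1))" by (simp only: mult.left_commute)
  next
    fix m assume m: "I m \<and> \<not> bval (Less (reg 2) (reg 1)) m"
    then obtain p where inv: "prime_inv n p p m" by (auto simp: I_def prime_inv_def) 
    have "prime p" unfolding prime_nat_iff'
      using inv by (auto simp: prime_inv_def)
    then have "P \<le> p" using inv next_prime_le[of p n] by (simp add: prime_inv_def P_def)
    then show "base_inv n m \<and> m 0 1 = int P" using inv by (auto simp: prime_inv_def P_def)
  qed simp
qed

section \<open>Searching for the parameter\<close>

definition param_body :: com where
  "param_body = Seq (set_reg 4 (Plus (reg 4) (Num 1)))
     (Seq (pow_code 5 (reg 4)) (Seq (pow_code 6 (Plus (reg 4) (Num 1))) (mul_code 7 (reg 5) (reg 1))))"

text \<open>The dummy values 0 and 1 in registers 7 and 6 make the first test succeed, so that the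
  first parameter examined is 1.\<close>

definition param_code :: com where
  "param_code = Seq (Seq (set_reg 4 (Num 0)) (Seq (set_reg 6 (Num 1)) (set_reg 7 (Num 0))))
     (While (Less (reg 7) (reg 6)) param_body)"

text \<open>The least \<open>t\<close> at which \<open>(2 t)\<^bsup>n - 1\<^esup> / p\<^bsup>t - 1\<^esup>\<close> stops increasing.\<close>

definition good_param :: "nat \<Rightarrow> nat \<Rightarrow> nat \<Rightarrow> bool" where
  "good_param n p t \<longleftrightarrow> 1 \<le> t \<and> t \<le> n \<and> (t + 1) ^ (n - 1) \<le> p * t ^ (n - 1) \<and>
     (\<forall>s. 1 \<le> s \<longrightarrow> s < t \<longrightarrow> p * s ^ (n - 1) < (s + 1) ^ (n - 1))"

definition param_inv :: "nat \<Rightarrow> nat \<Rightarrow> nat \<Rightarrow> mem \<Rightarrow> bool" where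
  "param_inv n p t m \<longleftrightarrow> base_inv n m \<and> m 0 1 = int p \<and> m 0 4 = int t \<and> t \<le> n \<and>
     (\<forall>s. 1 \<le> s \<longrightarrow> s < t \<longrightarrow> p * s ^ (n - 1) < (s + 1) ^ (n - 1)) \<and>
     (if t = 0 then m 0 6 = 1 \<and> m 0 7 = 0
      else m 0 6 = int ((t + 1) ^ (n - 1)) \<and> m 0 7 = int (p * t ^ (n - 1)))"

lemma hoare_param_body:
  assumes m1: "m1 0 0 = int n" "1 \<le> n" "m1 0 1 = int p" "m1 0 4 = int t" "t < n"
  shows "hoare (\<lambda>m. m = m1) param_body (200 * ((n + 2) * (n + 2)) + 50 * (p + 1))
    (\<lambda>m. agree {4, 5, 6, 7, 20, 21, 22} m1 m \<and> m 0 4 = int (t + 1) \<and>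
      m 0 6 = int ((t + 2) ^ (n - 1)) \<and> m 0 7 = int (p * (t + 1) ^ (n - 1)))"
proof -
  have 1: "hoare (\<lambda>m. m = m1) (set_reg 4 (Plus (reg 4) (Num 1))) 20 (\<lambda>m. agree {4} m1 m \<and> m 0 4 = int (t + 1))"
    by (rule hoare_straight) (use m1 in \<open>auto simp: agree_def\<close>)
  have 2: "hoare (\<lambda>m. agree {4} m1 m \<and> m 0 4 = int (t + 1)) (pow_code 5 (reg 4)) (n * (50 * (n + 3)))
     (\<lambda>m. agree {4, 5, 20, 21, 22} m1 m \<and> m 0 4 = int (t + 1) \<and> m 0 5 = int ((t + 1) ^ (n - 1)))"
  proof (rule hoare_fix)
    fix m2 assume m2: "agree {4} m1 m2 \<and> m2 0 4 = int (t + 1)"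
    have "hoare (\<lambda>m. m = m2) (pow_code 5 (reg 4)) (n * (50 * ((t + 1) + 2)))
       (\<lambda>m. agree {5, 20, 21, 22} m2 m \<and> m 0 5 = int ((t + 1) ^ (n - 1)))"
      by (rule hoare_pow) (use m1 m2 in \<open>auto simp: agree_def\<close>)
    then show "hoare (\<lambda>m. m = m2) (pow_code 5 (reg 4)) (n * (50 * (n + 3)))
     (\<lambda>m. agree {4, 5, 20, 21, 22} m1 m \<and> m 0 4 = int (t + 1) \<and> m 0 5 = int ((t + 1) ^ (n - 1)))"
      by (rule hoare_weaken) (use m1 m2 in \<open>auto simp: agree_def\<close>)
  qed
  have 3: "hoare (\<lambda>m. agree {4, 5, 20, 21, 22} m1 m \<and> m 0 4 = int (t + 1) \<and> m 0 5 = int ((t + 1) ^ (n - 1)))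
     (pow_code 6 (Plus (reg 4) (Num 1))) (n * (50 * (n + 3)))
     (\<lambda>m. agree {4, 5, 6, 20, 21, 22} m1 m \<and> m 0 4 = int (t + 1) \<and> m 0 5 = int ((t + 1) ^ (n - 1)) \<and>
       m 0 6 = int ((t + 2) ^ (n - 1)))"
  proof (rule hoare_fix)
    fix m2 assume m2: "agree {4, 5, 20, 21, 22} m1 m2 \<and> m2 0 4 = int (t + 1) \<and> m2 0 5 = int ((t + 1) ^ (n - 1))"
    have "hoare (\<lambda>m. m = m2) (pow_code 6 (Plus (reg 4) (Num 1))) (n * (50 * ((t + 2) + 2)))
       (\<lambda>m. agree {6, 20, 21, 22} m2 m \<and> m 0 6 = int ((t + 2) ^ (n - 1)))"
      by (rule hoare_pow) (use m1 m2 in \<open>auto simp: agree_def\<close>)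
    then show "hoare (\<lambda>m. m = m2) (pow_code 6 (Plus (reg 4) (Num 1))) (n * (50 * (n + 3)))
     (\<lambda>m. agree {4, 5, 6, 20, 21, 22} m1 m \<and> m 0 4 = int (t + 1) \<and> m 0 5 = int ((t + 1) ^ (n - 1)) \<and>
       m 0 6 = int ((t + 2) ^ (n - 1)))"
      by (rule hoare_weaken) (use m1 m2 in \<open>auto simp: agree_def\<close>)
  qed
  have 4: "hoare (\<lambda>m. agree {4, 5, 6, 20, 21, 22} m1 m \<and> m 0 4 = int (t + 1) \<and> m 0 5 = int ((t + 1) ^ (n - 1)) \<and>
       m 0 6 = int ((t + 2) ^ (n - 1))) (mul_code 7 (reg 5) (reg 1)) (50 * (p + 1))
     (\<lambda>m. agree {4, 5, 6, 7, 20, 21, 22} m1 m \<and> m 0 4 = int (t + 1) \<and>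
      m 0 6 = int ((t + 2) ^ (n - 1)) \<and> m 0 7 = int (p * (t + 1) ^ (n - 1)))"
  proof (rule hoare_fix)
    fix m2 assume m2: "agree {4, 5, 6, 20, 21, 22} m1 m2 \<and> m2 0 4 = int (t + 1) \<and> m2 0 5 = int ((t + 1) ^ (n - 1)) \<and>
       m2 0 6 = int ((t + 2) ^ (n - 1))"
    have "hoare (\<lambda>m. m = m2) (mul_code 7 (reg 5) (reg 1)) (50 * (p + 1))
       (\<lambda>m. agree {7, 20} m2 m \<and> m 0 7 = int ((t + 1) ^ (n - 1)) * int p)"
      by (rule hoare_mul) (use m1 m2 in \<open>auto simp: agree_def\<close>)
    then show "hoare (\<lambda>m. m = m2) (mul_code 7 (reg 5) (reg 1)) (50 * (p + 1))
     (\<lambda>m. agree {4, 5, 6, 7, 20, 21, 22} m1 m \<and> m 0 4 = int (t + 1) \<and>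
      m 0 6 = int ((t + 2) ^ (n - 1)) \<and> m 0 7 = int (p * (t + 1) ^ (n - 1)))"
      by (rule hoare_weaken) (use m1 m2 in \<open>auto simp: agree_def\<close>)
  qed
  have "hoare (\<lambda>m. m = m1) param_body (20 + (n * (50 * (n + 3)) + (n * (50 * (n + 3)) + 50 * (p + 1))))
    (\<lambda>m. agree {4, 5, 6, 7, 20, 21, 22} m1 m \<and> m 0 4 = int (t + 1) \<and>
      m 0 6 = int ((t + 2) ^ (n - 1)) \<and> m 0 7 = int (p * (t + 1) ^ (n - 1)))"
    unfolding param_body_def by (rule hoare_Seq[OF 1 hoare_Seq[OF 2 hoare_Seq[OF 3 4]]])
  then show ?thesis by (rule hoare_weaken) (auto simp: algebra_simps)
qed

lemma hoare_param:
  assumes n: "1 \<le> n" and p: "n < p"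
  shows "hoare (\<lambda>m. base_inv n m \<and> m 0 1 = int p) param_code
    ((n + 1) * (200 * ((n + 2) * (n + 2)) + 50 * (p + 1) + 40))
    (\<lambda>m. \<exists>t. good_param n p t \<and> base_inv n m \<and> m 0 1 = int p \<and> m 0 4 = int t)"
proof -
  define v :: "mem \<Rightarrow> nat" where "v m = n - nat (m 0 4)" for m
  define I where "I m \<longleftrightarrow> (\<exists>t. param_inv n p t m)" for m
  have 1: "hoare (\<lambda>m. base_inv n m \<and> m 0 1 = int p)
      (Seq (set_reg 4 (Num 0)) (Seq (set_reg 6 (Num 1)) (set_reg 7 (Num 0)))) 20 (\<lambda>m. I m \<and> v m \<le> n)"
    by (rule hoare_straight) (auto simp: I_def param_inv_def base_inv_def v_def)
  have 2: "hoare (\<lambda>m. I m \<and> bval (Less (reg 7) (reg 6)) m \<and> v m = k) param_body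
      (200 * ((n + 2) * (n + 2)) + 50 * (p + 1)) (\<lambda>m. I m \<and> v m < k)" for k
  proof (rule hoare_fix)
    fix m1 assume m1: "I m1 \<and> bval (Less (reg 7) (reg 6)) m1 \<and> v m1 = k"
    then obtain t where inv: "param_inv n p t m1" by (auto simp: I_def)
    have lt: "p * t ^ (n - 1) < (t + 1) ^ (n - 1)" if "t \<noteq> 0"
    proof -
      have "int (p * t ^ (n - 1)) < int ((t + 1) ^ (n - 1))"
        using inv m1 that by (auto simp: param_inv_def)
      then show ?thesis by (simp only: of_nat_less_iff)
    qed
    \<comment> \<open>At \<open>t = n\<close> the loop test fails by \<open>Suc_power_le\<close>, so
      the body never pushes the parameter beyond \<open>n\<close>.\<close>
    then have "t \<noteq> n" using Suc_power_le[OF n p] n by (metis not_less not_one_le_zero)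
    then have tn: "t < n" using inv by (simp add: param_inv_def)
    have "hoare (\<lambda>m. m = m1) param_body (200 * ((n + 2) * (n + 2)) + 50 * (p + 1))
      (\<lambda>m. agree {4, 5, 6, 7, 20, 21, 22} m1 m \<and> m 0 4 = int (t + 1) \<and>
      m 0 6 = int ((t + 2) ^ (n - 1)) \<and> m 0 7 = int (p * (t + 1) ^ (n - 1)))"
      by (rule hoare_param_body) (use inv n tn in \<open>auto simp: param_inv_def base_inv_def\<close>)
    then show "hoare (\<lambda>m. m = m1) param_body (200 * ((n + 2) * (n + 2)) + 50 * (p + 1)) (\<lambda>m. I m \<and> v m < k)"
    proof (rule hoare_weaken)
      fix m assume m: "agree {4, 5, 6, 7, 20, 21, 22} m1 m \<and> m 0 4 = int (t + 1) \<and>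
        m 0 6 = int ((t + 2) ^ (n - 1)) \<and> m 0 7 = int (p * (t + 1) ^ (n - 1))"
      have "p * s ^ (n - 1) < (s + 1) ^ (n - 1)" if "1 \<le> s" "s < t + 1" for s
        using inv lt that by (cases "s = t") (auto simp: param_inv_def)
      then have "param_inv n p (t + 1) m"
        using m inv tn by (auto simp: param_inv_def agree_def base_inv_def)
      moreover have "k = n - t" using m1 inv by (auto simp: v_def param_inv_def)
      moreover have "v m = n - (t + 1)" using m by (simp add: v_def nat_add_distrib)
      ultimately show "I m \<and> v m < k" using tn unfolding I_def by auto
    qed auto
  qed
  have "hoare (\<lambda>m. base_inv n m \<and> m 0 1 = int p) param_code
      (20 + (n + 1) * (1 + bcost (Less (reg 7) (reg 6)) + (200 * ((n + 2) * (n + 2)) + 50 * (p + 1))))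
      (\<lambda>m. I m \<and> \<not> bval (Less (reg 7) (reg 6)) m)"
    unfolding param_code_def by (rule hoare_Seq[OF 1 hoare_While[OF 2]])
  then show ?thesis
  proof (rule hoare_weaken)
    have "20 + (n + 1) * (1 + bcost (Less (reg 7) (reg 6)) + (200 * ((n + 2) * (n + 2)) + 50 * (p + 1))) \<le>
        (n + 1) * 20 + (n + 1) * (1 + bcost (Less (reg 7) (reg 6)) + (200 * ((n + 2) * (n + 2)) + 50 * (p + 1)))"
      by simp
    also have "\<dots> = (n + 1) * (20 + (1 + bcost (Less (reg 7) (reg 6)) + (200 * ((n + 2) * (n + 2)) + 50 * (p + 1))))"
      by (simp only: distrib_left)
    also have "\<dots> \<le> (n + 1) * (200 * ((n + 2) * (n + 2)) + 50 * (p + 1) + 40)"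
      by (rule mult_left_mono) auto
    finally show "20 + (n + 1) * (1 + bcost (Less (reg 7) (reg 6)) + (200 * ((n + 2) * (n + 2)) + 50 * (p + 1)))
      \<le> (n + 1) * (200 * ((n + 2) * (n + 2)) + 50 * (p + 1) + 40)" .
  next
    fix m assume m: "I m \<and> \<not> bval (Less (reg 7) (reg 6)) m"
    then obtain t where inv: "param_inv n p t m" by (auto simp: I_def)
    have "t \<noteq> 0"
    proof
      assume "t = 0"
      then show False using inv m by (simp add: param_inv_def)
    qed
    then have "int ((t + 1) ^ (n - 1)) \<le> int (p * t ^ (n - 1))" using inv m by (auto simp: param_inv_def)
    then have "(t + 1) ^ (n - 1) \<le> p * t ^ (n - 1)" by (simp only: of_nat_le_iff)
    then have "good_param n p t" using inv \<open>t \<noteq> 0\<close> by (auto simp: good_param_def param_inv_def)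
    then show "\<exists>t. good_param n p t \<and> base_inv n m \<and> m 0 1 = int p \<and> m 0 4 = int t"
      using inv by (auto simp: param_inv_def)
  qed simp
qed

section \<open>Pascal's triangle and the scaling of its rows\<close>

text \<open>Coefficient \<open>j\<close> of \<open>(X - 1)\<^sup>i\<close>; the exponent \<open>i + j\<close> avoids truncated subtraction.\<close>

definition signed_binomial :: "nat \<Rightarrow> nat \<Rightarrow> int" where
  "signed_binomial i j = (-1) ^ (i + j) * int (i choose j)"

definition row_scale :: "nat \<Rightarrow> nat \<Rightarrow> nat \<Rightarrow> int" where
  "row_scale p t i = (if i = 0 then int (2 * t) else if i < t then int p else 1)"

definition flat_pascal :: "nat \<Rightarrow> nat \<Rightarrow> int" where
  "flat_pascal n a = signed_binomial (a div n) (a mod n)"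

lemma signed_binomial_0: "signed_binomial 0 j = (if j = 0 then 1 else 0)"
  by (cases j) (auto simp: signed_binomial_def)

lemma signed_binomial_Suc:
  "signed_binomial (Suc i) (Suc j) = signed_binomial i j - signed_binomial i (Suc j)"
  "signed_binomial (Suc i) 0 = - signed_binomial i 0"
  by (simp_all add: signed_binomial_def algebra_simps)

text \<open>In row-major order, the entry to the left of the first entry of a row is the last one of the
  row before, which is \<open>0\<close> by triangularity. So Pascal's rule needs no case distinction.\<close>

lemma flat_pascal_step:
  assumes "n \<le> a" "a < n * n"
  shows "flat_pascal n a = (if a = n then 0 else flat_pascal n (a - n - 1)) - flat_pascal n (a - n)"
proof -
  define i where "i = (a - n) div n"
  define j where "j = (a - n) mod n"
  have n: "n > 0" using assms by (cases n) auto
  have j: "j < n" using n by (simp add: j_def)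
  have an: "a - n = i * n + j" by (simp add: i_def j_def)
  then have a: "a = Suc i * n + j" using assms by simp
  have i: "Suc i < n"
  proof (rule ccontr)
    assume "\<not> Suc i < n"
    then have "n * n \<le> Suc i * n" by (intro mult_right_mono) auto
    then show False using a assms by simp
  qed
  have 1: "flat_pascal n a = signed_binomial (Suc i) j"
    unfolding a flat_pascal_def using j n by (simp only: div_mult_self3 mod_mult_self3) simp
  have gen: "flat_pascal n (x * n + r) = signed_binomial x r" if "r < n" for x r
    using that unfolding flat_pascal_def by simp
  have 2: "flat_pascal n (a - n) = signed_binomial i j"
    unfolding flat_pascal_def by (simp add: i_def j_def)
  show ?thesis
  proof (cases j)
    case (Suc j')
    have "a - n - 1 = i * n + j'" using an Suc by simp
    then have "flat_pascal n (a - n - 1) = signed_binomial i j'"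
      using Suc j n unfolding flat_pascal_def by simp
    then show ?thesis using 1 2 Suc a by (simp add: signed_binomial_Suc)
  next
    case 0
    have "flat_pascal n (a - n - 1) = 0" if an_ne: "a \<noteq> n"
    proof -
      obtain i' where i': "i = Suc i'" using an_ne a 0 by (cases i) auto
      have "a - n - 1 = i' * n + (n - 1)" using an 0 i' n by simp
      then have "flat_pascal n (a - n - 1) = signed_binomial i' (n - 1)"
        using gen[of "n - 1" i'] n by (simp only:)
      then show ?thesis using i i' by (simp add: signed_binomial_def)
    qed
    then show ?thesis using 1 2 0 by (simp add: signed_binomial_Suc)
  qed
qed

definition regs :: "nat \<Rightarrow> nat \<Rightarrow> nat \<Rightarrow> mem \<Rightarrow> bool" where
  "regs n p t m \<longleftrightarrow> m 0 0 = int n \<and> m 0 1 = int p \<and> m 0 4 = int t"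

definition pascal_body :: com where
  "pascal_body = Seq (Assign 1 (reg 9)
       (Minus (Get 1 (Minus (Minus (reg 9) (reg 0)) (Num 1))) (Get 1 (Minus (reg 9) (reg 0)))))
     (set_reg 9 (Plus (reg 9) (Num 1)))"

definition pascal_code :: com where
  "pascal_code = Seq (Assign 1 (Num 0) (Num 1)) (Seq (mul_code 8 (reg 0) (reg 0)) (Seq (set_reg 9 (reg 0))
     (While (Less (reg 9) (reg 8)) pascal_body)))"

text \<open>The output array is described at all integers: for \<open>a = n\<close> the program
  reads index -1 and relies on the 0 there.\<close>

definition pascal_inv :: "nat \<Rightarrow> nat \<Rightarrow> nat \<Rightarrow> nat \<Rightarrow> mem \<Rightarrow> bool" where
  "pascal_inv n p t a m \<longleftrightarrow> regs n p t m \<and> m 0 8 = int (n * n) \<and> m 0 9 = int a \<and> n \<le> a \<and> a \<le> n * n \<and>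
     (\<forall>b. m 1 b = (if 0 \<le> b \<and> b < int a then flat_pascal n (nat b) else 0))"

lemma flat_pascal_first_row: "b < n \<Longrightarrow> flat_pascal n b = (if b = 0 then 1 else 0)"
  by (auto simp: flat_pascal_def signed_binomial_0)

lemma hoare_pascal:
  assumes n: "1 \<le> n"
  shows "hoare (\<lambda>m. base_inv n m \<and> regs n p t m) pascal_code (150 * (n * n + 1))
    (\<lambda>m. pascal_inv n p t (n * n) m)"
proof -
  define v :: "mem \<Rightarrow> nat" where "v m = n * n - nat (m 0 9)" for m
  define I where "I m \<longleftrightarrow> (\<exists>a. pascal_inv n p t a m)" for m
  let ?P1 = "\<lambda>m. regs n p t m \<and> m 1 = (\<lambda>b. if b = 0 then 1 else 0)"
  have 1: "hoare (\<lambda>m. base_inv n m \<and> regs n p t m) (Assign 1 (Num 0) (Num 1)) 3 ?P1"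
    by (rule hoare_straight) (auto simp: base_inv_def regs_def)
  have 2: "hoare ?P1 (mul_code 8 (reg 0) (reg 0)) (50 * (n + 1)) (\<lambda>m. ?P1 m \<and> m 0 8 = int (n * n))"
  proof (rule hoare_fix)
    fix m1 assume m1: "?P1 m1"
    have "hoare (\<lambda>m. m = m1) (mul_code 8 (reg 0) (reg 0)) (50 * (n + 1))
       (\<lambda>m. agree {8, 20} m1 m \<and> m 0 8 = int n * int n)"
      by (rule hoare_mul) (use m1 in \<open>auto simp: agree_def regs_def\<close>)
    then show "hoare (\<lambda>m. m = m1) (mul_code 8 (reg 0) (reg 0)) (50 * (n + 1)) (\<lambda>m. ?P1 m \<and> m 0 8 = int (n * n))"
      by (rule hoare_weaken) (use m1 in \<open>auto simp: agree_def regs_def\<close>)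
  qed
  have 3: "hoare (\<lambda>m. ?P1 m \<and> m 0 8 = int (n * n)) (set_reg 9 (reg 0)) 4 (\<lambda>m. I m \<and> v m \<le> n * n)"
  proof (rule hoare_straight)
    fix m assume m: "?P1 m \<and> m 0 8 = int (n * n)"
    define m' where "m' = m(0 := (m 0)(9 := m 0 0))"
    have "(if b = 0 then 1 else 0) = (if 0 \<le> b \<and> b < int n then flat_pascal n (nat b) else 0)" for b
      using flat_pascal_first_row[of "nat b" n] n by auto
    then have "pascal_inv n p t n m'"
      using m n by (simp add: pascal_inv_def m'_def regs_def)
    then show "wp (set_reg 9 (reg 0)) (\<lambda>m. I m \<and> v m \<le> n * n) m"
      unfolding I_def v_def by (auto simp: m'_def)
  qed auto
  have 4: "hoare (\<lambda>m. I m \<and> bval (Less (reg 9) (reg 8)) m \<and> v m = k) pascal_body 30 (\<lambda>m. I m \<and> v m < k)" for k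
  proof (rule hoare_straight)
    fix m assume m: "I m \<and> bval (Less (reg 9) (reg 8)) m \<and> v m = k"
    then obtain a where inv: "pascal_inv n p t a m" by (auto simp: I_def)
    have a: "n \<le> a" "a < n * n" "m 0 9 = int a" "m 0 0 = int n"
      using inv m by (auto simp: pascal_inv_def regs_def simp flip: of_nat_mult)
    have m1: "m 1 b = (if 0 \<le> b \<and> b < int a then flat_pascal n (nat b) else 0)" for b
      using inv by (simp add: pascal_inv_def)
    define m' where "m' = m(1 := (m 1)(int a := m 1 (int a - int n - 1) - m 1 (int a - int n)),
       0 := (m 0)(9 := int a + 1))"
    have "m 1 (int a - int n) = flat_pascal n (a - n)"
      unfolding m1 using a n by (simp add: nat_diff_distrib)
    moreover have "m 1 (int a - int n - 1) = (if a = n then 0 else flat_pascal n (a - n - 1))"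
      unfolding m1 using a n by (auto simp: nat_diff_distrib)
    ultimately have "m 1 (int a - int n - 1) - m 1 (int a - int n) = flat_pascal n a"
      using flat_pascal_step[OF a(1,2)] by simp
    then have "m' 1 b = (if 0 \<le> b \<and> b < int (a + 1) then flat_pascal n (nat b) else 0)" for b
      by (auto simp: m'_def m1[unfolded One_nat_def])
    moreover have "m' 0 k = (if k = 9 then int a + 1 else m 0 k)" for k by (simp add: m'_def)
    ultimately have "pascal_inv n p t (a + 1) m'"
      using inv a unfolding pascal_inv_def regs_def by simp
    then have "I m'" unfolding I_def by blast
    moreover have "v m' < k" using m a by (auto simp: v_def m'_def nat_add_distrib)
    ultimately show "wp pascal_body (\<lambda>m. I m \<and> v m < k) m"
      using a by (simp add: pascal_body_def m'_def)
  qed (simp add: pascal_body_def)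
  have "hoare (\<lambda>m. base_inv n m \<and> regs n p t m) pascal_code
      (3 + (50 * (n + 1) + (4 + (n * n + 1) * (1 + bcost (Less (reg 9) (reg 8)) + 30))))
      (\<lambda>m. I m \<and> \<not> bval (Less (reg 9) (reg 8)) m)"
    unfolding pascal_code_def by (rule hoare_Seq[OF 1 hoare_Seq[OF 2 hoare_Seq[OF 3 hoare_While[OF 4]]]])
  then show ?thesis
  proof (rule hoare_weaken)
    define q where "q = n * n"
    have "n \<le> q" by (simp add: q_def)
    then show "3 + (50 * (n + 1) + (4 + (n * n + 1) * (1 + bcost (Less (reg 9) (reg 8)) + 30))) \<le> 150 * (n * n + 1)"
      unfolding q_def[symmetric] by simp
  next
    fix m assume m: "I m \<and> \<not> bval (Less (reg 9) (reg 8)) m"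
    then obtain a where inv: "pascal_inv n p t a m" by (auto simp: I_def)
    then have "a = n * n" using m by (auto simp: pascal_inv_def simp flip: of_nat_mult)
    then show "pascal_inv n p t (n * n) m" using inv by simp
  qed simp
qed

definition scale_body :: com where
  "scale_body = Seq (set_reg 10 (Get 1 (reg 9))) (Seq (mul_code 11 (reg 10) (reg 1))
     (Seq (Assign 1 (reg 9) (reg 11)) (set_reg 9 (Plus (reg 9) (Num 1)))))"

text \<open>Rows 1 to \<open>t - 1\<close> occupy the contiguous indices from \<open>n\<close> to
  \<open>n * t - 1\<close>, so one loop scales them. Row 0 has a single nonzero entry, which is
  overwritten by \<open>2 * t\<close>.\<close>

definition scale_code :: com where
  "scale_code = Seq (mul_code 8 (reg 0) (reg 4)) (Seq (set_reg 9 (reg 0))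
     (Seq (While (Less (reg 9) (reg 8)) scale_body) (Assign 1 (Num 0) (Plus (reg 4) (reg 4)))))"

definition scale_inv :: "nat \<Rightarrow> nat \<Rightarrow> nat \<Rightarrow> nat \<Rightarrow> mem \<Rightarrow> bool" where
  "scale_inv n p t a m \<longleftrightarrow> regs n p t m \<and> m 0 8 = int (n * t) \<and> m 0 9 = int a \<and> n \<le> a \<and> a \<le> n * t \<and>
     (\<forall>b<n * n. m 1 (int b) = (if n \<le> b \<and> b < a then int p else 1) * flat_pascal n b)"

lemma hoare_scale_body:
  assumes inv: "scale_inv n p t a m1" and a: "a < n * t"
  shows "hoare (\<lambda>m. m = m1) scale_body (50 * (p + 1) + 30)
    (\<lambda>m. scale_inv n p t (a + 1) m)"
proof -
  have m1: "m1 0 0 = int n" "m1 0 1 = int p" "m1 0 4 = int t" "m1 0 9 = int a"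
    using inv by (auto simp: scale_inv_def regs_def)
  have 1: "hoare (\<lambda>m. m = m1) (set_reg 10 (Get 1 (reg 9))) 10 (\<lambda>m. agree {10} m1 m \<and> m 0 10 = m1 1 (int a))"
    by (rule hoare_straight) (use m1 in \<open>auto simp: agree_def\<close>)
  have 2: "hoare (\<lambda>m. agree {10} m1 m \<and> m 0 10 = m1 1 (int a)) (mul_code 11 (reg 10) (reg 1)) (50 * (p + 1))
     (\<lambda>m. agree {10, 11, 20} m1 m \<and> m 0 11 = m1 1 (int a) * int p)"
  proof (rule hoare_fix)
    fix m2 assume m2: "agree {10} m1 m2 \<and> m2 0 10 = m1 1 (int a)"
    have "hoare (\<lambda>m. m = m2) (mul_code 11 (reg 10) (reg 1)) (50 * (p + 1))
       (\<lambda>m. agree {11, 20} m2 m \<and> m 0 11 = m1 1 (int a) * int p)"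
      by (rule hoare_mul) (use m1 m2 in \<open>auto simp: agree_def\<close>)
    then show "hoare (\<lambda>m. m = m2) (mul_code 11 (reg 10) (reg 1)) (50 * (p + 1))
     (\<lambda>m. agree {10, 11, 20} m1 m \<and> m 0 11 = m1 1 (int a) * int p)"
      by (rule hoare_weaken) (use m1 m2 in \<open>auto simp: agree_def\<close>)
  qed
  have 3: "hoare (\<lambda>m. agree {10, 11, 20} m1 m \<and> m 0 11 = m1 1 (int a) * int p)
     (Seq (Assign 1 (reg 9) (reg 11)) (set_reg 9 (Plus (reg 9) (Num 1)))) 20 (\<lambda>m. scale_inv n p t (a + 1) m)"
  proof (rule hoare_straight)
    fix m assume m: "agree {10, 11, 20} m1 m \<and> m 0 11 = m1 1 (int a) * int p"
    define m' where "m' = m(1 := (m 1)(int a := m1 1 (int a) * int p), 0 := (m 0)(9 := int a + 1))"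
    have "m' 1 (int b) = (if n \<le> b \<and> b < a + 1 then int p else 1) * flat_pascal n b" if "b < n * n" for b
      using m inv that by (auto simp: m'_def agree_def scale_inv_def)
    then have "scale_inv n p t (a + 1) m'"
      using inv a m by (simp add: scale_inv_def regs_def m'_def agree_def)
    moreover have "m 0 9 = int a" "m 0 11 = m1 1 (int a) * int p"
      using m m1 by (auto simp: agree_def)
    ultimately show "wp (Seq (Assign 1 (reg 9) (reg 11)) (set_reg 9 (Plus (reg 9) (Num 1)))) (\<lambda>m. scale_inv n p t (a + 1) m) m"
      by (simp add: m'_def)
  qed auto
  show ?thesis unfolding scale_body_def
    by (rule hoare_weaken[OF hoare_Seq[OF 1 hoare_Seq[OF 2 3]]]) auto
qed

lemma hoare_scale:
  assumes t: "1 \<le> t" "t \<le> n"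
  shows "hoare (\<lambda>m. pascal_inv n p t (n * n) m) scale_code (200 * ((n * n + 1) * (p + 1)))
    (\<lambda>m. \<forall>i<n. \<forall>j<n. m 1 (int (i * n + j)) = row_scale p t i * signed_binomial i j)"
proof -
  define v :: "mem \<Rightarrow> nat" where "v m = n * t - nat (m 0 9)" for m
  define I where "I m \<longleftrightarrow> (\<exists>a. scale_inv n p t a m)" for m
  let ?P1 = "\<lambda>m. regs n p t m \<and> (\<forall>b<n * n. m 1 (int b) = flat_pascal n b) \<and> m 0 8 = int (n * t)"
  have 1: "hoare (\<lambda>m. pascal_inv n p t (n * n) m) (mul_code 8 (reg 0) (reg 4)) (50 * (t + 1)) ?P1"
  proof (rule hoare_fix)
    fix m1 assume m1: "pascal_inv n p t (n * n) m1"
    have "hoare (\<lambda>m. m = m1) (mul_code 8 (reg 0) (reg 4)) (50 * (t + 1))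
       (\<lambda>m. agree {8, 20} m1 m \<and> m 0 8 = int n * int t)"
      by (rule hoare_mul) (use m1 in \<open>auto simp: agree_def regs_def pascal_inv_def\<close>)
    then show "hoare (\<lambda>m. m = m1) (mul_code 8 (reg 0) (reg 4)) (50 * (t + 1)) ?P1"
      by (rule hoare_weaken) (use m1 in \<open>auto simp: agree_def regs_def pascal_inv_def simp flip: of_nat_mult\<close>)
  qed
  have 2: "hoare ?P1 (set_reg 9 (reg 0)) 4 (\<lambda>m. I m \<and> v m \<le> n * t)"
  proof (rule hoare_straight)
    fix m assume m: "?P1 m"
    define m' where "m' = m(0 := (m 0)(9 := m 0 0))"
    have "scale_inv n p t n m'"
      using m t by (simp add: scale_inv_def m'_def regs_def)
    then show "wp (set_reg 9 (reg 0)) (\<lambda>m. I m \<and> v m \<le> n * t) m"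
      unfolding I_def v_def by (auto simp: m'_def)
  qed auto
  have 3: "hoare (\<lambda>m. I m \<and> bval (Less (reg 9) (reg 8)) m \<and> v m = k) scale_body (50 * (p + 1) + 30)
      (\<lambda>m. I m \<and> v m < k)" for k
  proof (rule hoare_fix)
    fix m1 assume m1: "I m1 \<and> bval (Less (reg 9) (reg 8)) m1 \<and> v m1 = k"
    then obtain a where inv: "scale_inv n p t a m1" by (auto simp: I_def)
    then have a: "a < n * t" "m1 0 9 = int a" using m1 by (auto simp: scale_inv_def simp flip: of_nat_mult)
    show "hoare (\<lambda>m. m = m1) scale_body (50 * (p + 1) + 30) (\<lambda>m. I m \<and> v m < k)"
    proof (rule hoare_weaken[OF hoare_scale_body[OF inv a(1)]])
      fix m assume m: "scale_inv n p t (a + 1) m"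
      then have "m 0 9 = int (a + 1)" by (simp add: scale_inv_def)
      then show "I m \<and> v m < k" using m m1 a by (auto simp: I_def v_def nat_add_distrib)
    qed auto
  qed
  have 4: "hoare (\<lambda>m. I m \<and> \<not> bval (Less (reg 9) (reg 8)) m) (Assign 1 (Num 0) (Plus (reg 4) (reg 4))) 20
    (\<lambda>m. \<forall>i<n. \<forall>j<n. m 1 (int (i * n + j)) = row_scale p t i * signed_binomial i j)"
  proof (rule hoare_straight)
    fix m assume m: "I m \<and> \<not> bval (Less (reg 9) (reg 8)) m"
    then obtain a where inv: "scale_inv n p t a m" by (auto simp: I_def)
    then have "a = n * t" using m by (auto simp: scale_inv_def simp flip: of_nat_mult)
    then have m1: "m 1 (int b) = (if n \<le> b \<and> b < n * t then int p else 1) * flat_pascal n b" if "b < n * n" for b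
      using inv that by (simp add: scale_inv_def)
    have "((m 1)(0 := m 0 4 + m 0 4)) (int (i * n + j)) = row_scale p t i * signed_binomial i j"
      if ij: "i < n" "j < n" for i j
    proof (cases "i * n + j = 0")
      case True
      then have "i = 0" "j = 0" using ij by auto
      then show ?thesis using inv by (simp add: row_scale_def signed_binomial_0 scale_inv_def regs_def)
    next
      case False
      have "Suc i * n \<le> n * n" using ij by (intro mult_right_mono) auto
      then have b: "i * n + j < n * n" using ij by simp
      have fp: "flat_pascal n (i * n + j) = signed_binomial i j"
        using ij by (simp add: flat_pascal_def)
      have "i < t \<longleftrightarrow> i * n + j < n * t"
      proof
        assume "i < t"
        then have "Suc i * n \<le> t * n" by (intro mult_right_mono) auto
        then show "i * n + j < n * t" using ij by (simp add: mult.commute)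
      next
        assume "i * n + j < n * t"
        have "i * n \<le> i * n + j" by simp
        also have "\<dots> < t * n" using \<open>i * n + j < n * t\<close> by (simp only: mult.commute)
        finally show "i < t" by simp
      qed
      moreover have "n \<le> i * n + j \<longleftrightarrow> i \<noteq> 0" using ij by (cases i) auto
      ultimately have "m 1 (int (i * n + j)) = (if i \<noteq> 0 \<and> i < t then int p else 1) * signed_binomial i j"
        using m1[OF b] fp by simp
      \<comment> \<open>In row 0 the loop leaves the scale 1 in place of \<open>2 * t\<close>; off
        the first entry both give 0.\<close>
      moreover have "signed_binomial i j = 0" if "i = 0"
        using False that by (simp add: signed_binomial_0)
      moreover have "int (i * n + j) \<noteq> 0" using False by linarith
      ultimately show ?thesis by (auto simp: row_scale_def)
    qed
    then show "wp (Assign 1 (Num 0) (Plus (reg 4) (reg 4)))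
        (\<lambda>m. \<forall>i<n. \<forall>j<n. m 1 (int (i * n + j)) = row_scale p t i * signed_binomial i j) m"
      by simp
  qed auto
  have "hoare (\<lambda>m. pascal_inv n p t (n * n) m) scale_code
      (50 * (t + 1) + (4 + ((n * t + 1) * (1 + bcost (Less (reg 9) (reg 8)) + (50 * (p + 1) + 30)) + 20)))
    (\<lambda>m. \<forall>i<n. \<forall>j<n. m 1 (int (i * n + j)) = row_scale p t i * signed_binomial i j)"
    unfolding scale_code_def by (rule hoare_Seq[OF 1 hoare_Seq[OF 2 hoare_Seq[OF hoare_While[OF 3] 4]]])
  then show ?thesis
  proof (rule hoare_weaken)
    have "t \<le> n * n" using t by (metis le_trans le_square)
    have "(n * t + 1) * (1 + bcost (Less (reg 9) (reg 8)) + (50 * (p + 1) + 30)) \<le> (n * n + 1) * (100 * (p + 1))"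
      using t by (intro mult_mono) auto
    moreover have "50 * (t + 1) + 24 \<le> (n * n + 1) * 74 * 1" using \<open>t \<le> n * n\<close> by simp
    moreover have "(n * n + 1) * 74 * 1 \<le> (n * n + 1) * 74 * (p + 1)" by (rule mult_left_mono) auto
    ultimately show "50 * (t + 1) + (4 + ((n * t + 1) * (1 + bcost (Less (reg 9) (reg 8)) + (50 * (p + 1) + 30)) + 20))
      \<le> 200 * ((n * n + 1) * (p + 1))" by (simp add: algebra_simps)
  qed auto
qed

definition basis_code :: com where
  "basis_code = Seq prime_code (Seq param_code (Seq pascal_code scale_code))"

definition time_bound :: "nat \<Rightarrow> nat \<Rightarrow> nat" where
  "time_bound n p = 50 * ((p * p + p + 1) * (p + 1)) +
     ((n + 1) * (200 * ((n + 2) * (n + 2)) + 50 * (p + 1) + 40) +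
     (150 * (n * n + 1) + 200 * ((n * n + 1) * (p + 1))))"

lemma hoare_basis:
  assumes n: "1 \<le> n"
  defines "P \<equiv> next_prime n"
  shows "hoare (\<lambda>m. m = input_mem n) basis_code (time_bound n P)
    (\<lambda>m. \<exists>t. good_param n P t \<and>
      (\<forall>i<n. \<forall>j<n. m 1 (int (i * n + j)) = row_scale P t i * signed_binomial i j))"
proof -
  let ?Q = "\<lambda>m. \<exists>t. good_param n P t \<and>
      (\<forall>i<n. \<forall>j<n. m 1 (int (i * n + j)) = row_scale P t i * signed_binomial i j)"
  have "hoare (\<lambda>m. \<exists>t. good_param n P t \<and> base_inv n m \<and> m 0 1 = int P \<and> m 0 4 = int t)
      (Seq pascal_code scale_code) (150 * (n * n + 1) + 200 * ((n * n + 1) * (P + 1))) ?Q"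
  proof (rule hoare_all)
    fix t
    show "hoare (\<lambda>m. good_param n P t \<and> base_inv n m \<and> m 0 1 = int P \<and> m 0 4 = int t)
      (Seq pascal_code scale_code) (150 * (n * n + 1) + 200 * ((n * n + 1) * (P + 1))) ?Q"
    proof (cases "good_param n P t")
      case True
      then have "1 \<le> t" "t \<le> n" by (auto simp: good_param_def)
      show ?thesis
        by (rule hoare_weaken[OF hoare_Seq[OF hoare_pascal[OF n] hoare_scale[OF \<open>1 \<le> t\<close> \<open>t \<le> n\<close>]]])
          (use True in \<open>auto simp: regs_def base_inv_def\<close>)
    qed (simp add: hoare_def)
  qed
  then show ?thesis
    unfolding basis_code_def time_bound_def P_def
    by (rule hoare_Seq[OF hoare_prime[OF n] hoare_Seq[OF hoare_param[OF n next_prime_gt]]])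
qed

section \<open>The packing\<close>

definition basis_matrix :: "nat \<Rightarrow> nat \<Rightarrow> nat \<Rightarrow> nat \<Rightarrow> nat \<Rightarrow> int" where
  "basis_matrix n p t i j = (if i < n \<and> j < n then row_scale p t i * signed_binomial i j else 0)"

lemma signed_binomial_power_sum:
  assumes "k < i" "i < n"
  shows "(\<Sum>j<n. signed_binomial i j * int j ^ k) = 0"
proof -
  have "(\<Sum>j<n. signed_binomial i j * int j ^ k) = (\<Sum>j\<le>i. signed_binomial i j * int j ^ k)"
    using assms(2) by (intro sum.mono_neutral_right) (auto simp: signed_binomial_def)
  also have "\<dots> = (-1) ^ i * (\<Sum>j\<le>i. (-1) ^ j * int (i choose j) * int j ^ k)"
    unfolding sum_distrib_left by (intro sum.cong) (auto simp: signed_binomial_def power_add)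
  finally show ?thesis using alternating_binomial_power_sum[OF assms(1)] by simp
qed

text \<open>Power sums of order below \<open>i\<close> vanish on row \<open>i\<close> as finite
  differences. For \<open>1 \<le> i \<le> k\<close> the scale \<open>p\<close> gives divisibility.
  Row 0 is supported at \<open>j = 0\<close>, which contributes \<open>2 * t\<close> for
  \<open>k = 0\<close> and nothing for larger \<open>k\<close>.\<close>

lemma basis_matrix_power_sum:
  assumes "i < n" "k < t" "t \<le> n"
  shows "(if k = 0 then int (2 * t) else int p) dvd (\<Sum>j<n. basis_matrix n p t i j * int j ^ k)"
proof -
  have eq: "(\<Sum>j<n. basis_matrix n p t i j * int j ^ k) =
      row_scale p t i * (\<Sum>j<n. signed_binomial i j * int j ^ k)"
    unfolding sum_distrib_left using assms by (intro sum.cong) (auto simp: basis_matrix_def)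
  consider "k < i" | "i = 0" "k = 0" | "1 \<le> k" "i = 0" | "1 \<le> k" "1 \<le> i" "i < t" using assms by linarith
  then show ?thesis
  proof cases
    case 1
    then show ?thesis unfolding eq using signed_binomial_power_sum assms by simp
  next
    case 2
    then show ?thesis unfolding eq by (simp add: row_scale_def)
  next
    case 3
    then have "(\<Sum>j<n. signed_binomial i j * int j ^ k) = 0"
      by (intro sum.neutral) (auto simp: signed_binomial_0)
    then show ?thesis unfolding eq by simp
  next
    case 4
    then show ?thesis unfolding eq by (simp add: row_scale_def)
  qed
qed

lemma lattice_vector_norm:
  fixes c :: "nat \<Rightarrow> int" and n p t :: nat
  defines "x \<equiv> \<lambda>j. \<Sum>i<n. c i * basis_matrix n p t i j"
  assumes p: "prime p" "n < p" and t: "1 \<le> t" "t \<le> n" and nz: "\<exists>j<n. x j \<noteq> 0"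
  shows "int (2 * t) \<le> (\<Sum>j<n. \<bar>x j\<bar>)"
proof (rule l1_norm_ge[OF p(1)])
  have dvd: "(if k = 0 then int (2 * t) else int p) dvd (\<Sum>j<n. x j * int j ^ k)" if "k < t" for k
  proof -
    have "(\<Sum>j<n. x j * int j ^ k) = (\<Sum>i<n. c i * (\<Sum>j<n. basis_matrix n p t i j * int j ^ k))"
      unfolding x_def sum_distrib_right sum_distrib_left by (subst sum.swap) (simp add: mult.assoc)
    moreover have "(if k = 0 then int (2 * t) else int p) dvd
        (\<Sum>i<n. c i * (\<Sum>j<n. basis_matrix n p t i j * int j ^ k))"
      by (rule dvd_sum, rule dvd_mult, rule basis_matrix_power_sum[OF _ that t(2)]) simp
    ultimately show ?thesis by simp
  qed
  show "int (2 * t) dvd (\<Sum>j<n. x j)" using dvd[of 0] t by simp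
  show "int p dvd (\<Sum>j<n. x j * int j ^ k)" if "1 \<le> k" "k < t" for k
    using dvd[of k] that by simp
qed (use p t nz in auto)

lemma lower_triangular_basis:
  assumes "1 \<le> t" "0 < p"
  shows "lower_triangular n (\<lambda>i j. real_of_int (basis_matrix n p t i j))"
  using assms by (auto simp: lower_triangular_def basis_matrix_def row_scale_def signed_binomial_def)

lemma prod_row_scale:
  assumes "1 \<le> t" "t \<le> n"
  shows "(\<Prod>i<n. real_of_int (row_scale p t i)) = 2 * real t * real p ^ (t - 1)"
proof -
  have "(\<Prod>i<n. real_of_int (row_scale p t i)) = (\<Prod>i<t. real_of_int (row_scale p t i))"
    using assms by (intro prod.mono_neutral_right) (auto simp: row_scale_def)
  also have "{..<t} = insert 0 {1..<t}" using assms by auto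
  also have "(\<Prod>i\<in>insert 0 {1..<t}. real_of_int (row_scale p t i)) = 2 * real t * (\<Prod>i\<in>{1..<t}. real p)"
    by (auto simp: row_scale_def intro!: prod.cong)
  finally show ?thesis by simp
qed

lemma lattice_det_basis:
  assumes "1 \<le> t" "t \<le> n" "0 < p"
  shows "lattice_det n (\<lambda>i j. real_of_int (basis_matrix n p t i j)) = 2 * real t * real p ^ (t - 1)"
proof -
  have "lattice_det n (\<lambda>i j. real_of_int (basis_matrix n p t i j)) =
      (\<Prod>i<n. real_of_int (basis_matrix n p t i i))"
    using assms by (intro lattice_det_lower_triangular lower_triangular_basis) auto
  also have "\<dots> = (\<Prod>i<n. real_of_int (row_scale p t i))"
    by (intro prod.cong) (auto simp: basis_matrix_def signed_binomial_def)
  finally show ?thesis using prod_row_scale assms by simp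
qed

lemma basis_packing:
  fixes n p t :: nat
  defines "b \<equiv> \<lambda>i j. real_of_int (basis_matrix n p t i j)"
  assumes p: "prime p" "n < p" and t: "1 \<le> t" "t \<le> n" and r: "0 < r" "r \<le> real t"
  shows "\<exists>L. lattice_basis n b L \<and> lattice_packing n L r"
proof -
  define L where "L = {(\<lambda>j. \<Sum>i<n. of_int (k i) * b i j) | k :: nat \<Rightarrow> int. True}"
  have "0 < p" using p by simp
  have basis: "lattice_basis n b L"
    unfolding lattice_basis_def
  proof (intro conjI allI impI)
    show "lin_indep n b"
      unfolding b_def by (intro lin_indep_lower_triangular lower_triangular_basis) (use t \<open>0 < p\<close> in auto)
    show "b i \<in> topspace (Euclidean_space n)" for i
      by (simp add: topspace_Euclidean_space b_def basis_matrix_def)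
  qed (rule L_def)
  have "is_lattice n L" by (rule is_lattice_integral_basis[OF basis]) (simp add: b_def)
  moreover have "2 * r \<le> l1_dist n x y" if xy: "x \<in> L" "y \<in> L" "x \<noteq> y" for x y
  proof -
    obtain k l :: "nat \<Rightarrow> int" where kl: "x = (\<lambda>j. \<Sum>i<n. of_int (k i) * b i j)"
        "y = (\<lambda>j. \<Sum>i<n. of_int (l i) * b i j)"
      using xy unfolding L_def by blast
    define z where "z j = (\<Sum>i<n. (k i - l i) * basis_matrix n p t i j)" for j
    have z: "x j - y j = real_of_int (z j)" for j
      by (simp add: kl z_def b_def left_diff_distrib sum_subtractf)
    have "\<exists>j<n. z j \<noteq> 0"
    proof (rule ccontr)
      assume "\<not> (\<exists>j<n. z j \<noteq> 0)"
      moreover have "z j = 0" if "\<not> j < n" for j using that by (simp add: z_def basis_matrix_def)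
      ultimately have "x j = y j" for j using z[of j] by (cases "j < n") auto
      then show False using \<open>x \<noteq> y\<close> by auto
    qed
    then have "int (2 * t) \<le> (\<Sum>j<n. \<bar>z j\<bar>)"
      unfolding z_def by (intro lattice_vector_norm p t)
    then have "real_of_int (int (2 * t)) \<le> real_of_int (\<Sum>j<n. \<bar>z j\<bar>)" by (simp only: of_int_le_iff)
    then show ?thesis using r by (simp add: l1_dist_def z)
  qed
  ultimately show ?thesis using basis r unfolding lattice_packing_def by blast
qed

text \<open>The maximum is attained at some \<open>s\<close>, \<open>density_le_gain\<close> bounds
  it by the gain at a possibly different \<open>u\<close>, and \<open>gain_maximal\<close> passes
  from \<open>u\<close> to \<open>t\<close>.\<close>

lemma max_density:
  fixes n t :: nat
  defines "p \<equiv> next_prime n"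
  assumes n: "1 \<le> n" and t: "good_param n p t"
  defines "D \<equiv> MAX s\<in>{1..n}. (2 * real s) ^ n / (fact n * real p ^ s)"
  shows "0 < D" and "D \<le> (2 * real t) ^ n / (fact n * (2 * real t * real p ^ (t - 1)))"
proof -
  have p: "prime p" "n < p" unfolding p_def by (rule prime_next_prime next_prime_gt)+
  have "D \<in> (\<lambda>s. (2 * real s) ^ n / (fact n * real p ^ s)) ` {1..n}"
    unfolding D_def by (rule Max_in) (use n in auto)
  then obtain s where s: "1 \<le> s" "s \<le> n" "D = (2 * real s) ^ n / (fact n * real p ^ s)" by auto
  show "0 < D" using s p by simp
  obtain u where u: "u \<ge> 1" "(2 * real s) ^ n / real p ^ s \<le> (2 * real u) ^ (n - 1) / real p ^ (u - 1)"
    using density_le_gain[OF p s(1,2)] by blast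
  have "(2 * real u) ^ (n - 1) / real p ^ (u - 1) \<le> (2 * real t) ^ (n - 1) / real p ^ (t - 1)"
    using t u(1) p by (intro gain_maximal) (auto simp: good_param_def)
  moreover have "(2 * real t) ^ n = 2 * real t * (2 * real t) ^ (n - 1)" using n by (cases n) auto
  moreover have "t > 0" using t by (simp add: good_param_def)
  ultimately have "(2 * real s) ^ n / real p ^ s \<le> (2 * real t) ^ n / (2 * real t * real p ^ (t - 1))"
    using u(2) by simp
  then have "(2 * real s) ^ n / real p ^ s / fact n \<le> (2 * real t) ^ n / (2 * real t * real p ^ (t - 1)) / fact n"
    by (rule divide_right_mono) simp
  then show "D \<le> (2 * real t) ^ n / (fact n * (2 * real t * real p ^ (t - 1)))"
    by (simp add: s(3) mult_ac)
qed

text \<open>This is \<open>time_bound\<close> with the prime replaced by its bound from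
  \<open>next_prime_bound\<close>.\<close>

definition time_poly :: "nat poly" where
  "time_poly = (let x = [:0, 1:]; p = 2 * (x + 1)\<^sup>2 in
     50 * ((p * p + p + 1) * (p + 1)) +
     ((x + 1) * (200 * ((x + 2) * (x + 2)) + 50 * (p + 1) + 40) +
     (150 * (x * x + 1) + 200 * ((x * x + 1) * (p + 1)))))"

lemma time_bound_le: "time_bound n (next_prime n) \<le> poly time_poly n"
proof -
  have "time_bound n (next_prime n) \<le> time_bound n (2 * (n + 1)\<^sup>2)"
    unfolding time_bound_def by (intro add_mono mult_mono next_prime_bound order_refl zero_le)
  also have "\<dots> = poly time_poly n"
    by (simp add: time_bound_def time_poly_def Let_def)
  finally show ?thesis .
qed

theorem theorem2p1:
  shows "\<exists>(P :: com) (q :: nat poly). \<forall>n\<ge>1. \<exists>T m L r.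
           runs P (input_mem n) T m \<and> T \<le> poly q n \<and>
           lattice_basis n (output_vectors n m) L \<and>
           lattice_packing n L r \<and>
           packing_density n (output_vectors n m) r =
             (MAX t\<in>{1..n}. (2 * real t) ^ n / (fact n * real (next_prime n) ^ t))"
proof (rule exI[of _ basis_code], rule exI[of _ time_poly], intro allI impI)
  fix n :: nat assume n: "1 \<le> n"
  define p where "p = next_prime n"
  define D where "D = (MAX t\<in>{1..n}. (2 * real t) ^ n / (fact n * real p ^ t))"
  have p: "prime p" "n < p" unfolding p_def by (rule prime_next_prime next_prime_gt)+
  obtain T m t where run: "runs basis_code (input_mem n) T m" "T \<le> time_bound n p"
    and t: "good_param n p t"
    and m: "\<And>i j. i < n \<Longrightarrow> j < n \<Longrightarrow> m 1 (int (i * n + j)) = row_scale p t i * signed_binomial i j"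
    using hoare_basis[OF n, unfolded hoare_def, rule_format, OF refl] unfolding p_def[symmetric] by blast
  have tn: "1 \<le> t" "t \<le> n" using t by (auto simp: good_param_def)
  have out: "output_vectors n m = (\<lambda>i j. real_of_int (basis_matrix n p t i j))"
  proof (intro ext)
    fix i j
    show "output_vectors n m i j = real_of_int (basis_matrix n p t i j)"
      using m[of i j] by (simp add: output_vectors_def basis_matrix_def)
  qed
  have det: "lattice_det n (output_vectors n m) = 2 * real t * real p ^ (t - 1)"
    unfolding out using tn p by (intro lattice_det_basis) auto
  \<comment> \<open>At radius \<open>t\<close> the lattice is at least as dense as claimed; the
    radius is lowered until the density is exactly \<open>D\<close>.\<close>
  obtain r where r: "0 < r" "r \<le> real t" "(2 * r) ^ n / (fact n * (2 * real t * real p ^ (t - 1))) = D"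
    using exists_radius[of n D "fact n * (2 * real t * real p ^ (t - 1))" "real t"]
      max_density[OF n t[unfolded p_def]] n tn p unfolding D_def p_def by auto
  obtain L where "lattice_basis n (output_vectors n m) L" "lattice_packing n L r"
    using basis_packing[OF p tn r(1,2)] unfolding out by blast
  moreover have "packing_density n (output_vectors n m) r = D"
    unfolding packing_density_def det by (rule r(3))
  moreover have "T \<le> poly time_poly n" using run(2) time_bound_le[of n] unfolding p_def by simp
  ultimately show "\<exists>T m L r. runs basis_code (input_mem n) T m \<and> T \<le> poly time_poly n \<and>
           lattice_basis n (output_vectors n m) L \<and> lattice_packing n L r \<and>
           packing_density n (output_vectors n m) r =
             (MAX t\<in>{1..n}. (2 * real t) ^ n / (fact n * real (next_prime n) ^ t))"
    using run(1) unfolding D_def p_def by blast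
qed

end
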